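(* The Riemann Hypothesis is true if and only if for every compact disc $K$ contained in $\{\tfrac12<\Re(s)<1\}$ there exists $N_0\in\mathbb{N}$ such that for infinitely many $N>N_0$, $\phi_N(s)\neq0$ for all $s\in K$, where $\phi_N(s)=\sum_{n=1}^{N}\frac{(-1)^{n-1}}{n^s}$.
   Context: $\zeta$ is the Riemann zeta function; the Riemann Hypothesis states that every zero of $\zeta$ in the critical strip $0<\Re(s)<1$ has real part $\tfrac12$. *)

theory Defs
  imports "HOL-Complex_Analysis.Complex_Analysis"
begin

definition zeta_spec :: "(complex \<Rightarrow> complex) \<Rightarrow> bool" where
  "zeta_spec f \<longleftrightarrow>
     f holomorphic_on - {1} \<and>
     (\<forall>s. Re s > 1 \<longrightarrow> (\<lambda>n. 1 / of_nat (Suc n) powr s) sums f s) \<and>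
     f 1 = 0"

text \<open>The value \<open>0\<close> at the pole \<open>s = 1\<close> is a dummy value, which makes the specification determine
  the function uniquely. Existence and uniqueness are shown in \<open>zeta_spec_ex1\<close> below.\<close>

definition zeta :: "complex \<Rightarrow> complex" where
  "zeta = (THE f. zeta_spec f)"

definition Riemann_Hypothesis :: bool where
  "Riemann_Hypothesis \<longleftrightarrow> (\<forall>s. 0 < Re s \<and> Re s < 1 \<and> zeta s = 0 \<longrightarrow> Re s = 1 / 2)"

definition phi :: "nat \<Rightarrow> complex \<Rightarrow> complex" where
  "phi N s = (\<Sum>n = 1..N. (-1) ^ (n - 1) / of_nat n powr s)"


subsection \<open>Existence and uniqueness of the analytic continuation\<close>

lemma zeta_spec_unique:
  assumes "zeta_spec f" "zeta_spec g"
  shows "f = g"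
proof
  fix s
  show "f s = g s"
  proof (cases "s = 1")
    case True
    thus ?thesis using assms by (simp add: zeta_spec_def)
  next
    case False
    show ?thesis
    proof (rule analytic_continuation_open[of "{s. Re s > 1}" "- {1}" f g s])
      show "open {s. Re s > 1}" by (rule open_halfspace_Re_gt)
      show "{s. Re s > 1} \<noteq> {}" by (auto intro!: exI[of _ 2])
      show "connected (- {1::complex})"
        by (rule connected_punctured_universe) simp
      show "f z = g z" if "z \<in> {s. Re s > 1}" for z
        using assms that sums_unique2 by (force simp: zeta_spec_def)
    qed (use assms False in \<open>auto simp: zeta_spec_def\<close>)
  qed
qed

text \<open>The remainder of the binomial expansion of \<open>(x + 1) powr (1 - s) - x powr (1 - s)\<close>
  at \<open>x = Suc n\<close>, after \<open>M\<close> terms\<close>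

definition zeta_rem :: "nat \<Rightarrow> nat \<Rightarrow> complex \<Rightarrow> complex" where
  "zeta_rem M n s = (of_nat (Suc n) + 1) powr (1 - s) -
     (\<Sum>i\<le>M. ((1 - s) gchoose i) * of_nat (Suc n) powr (1 - s - of_nat i))"

lemma norm_zeta_rem_le:
  assumes "Re s + real M > 0"
  shows "norm (zeta_rem M n s) \<le>
           norm (fact (Suc M) * ((1 - s) gchoose Suc M)) / fact M * real (Suc n) powr (- Re s - real M)"
proof -
  define f where "f = (\<lambda>i x. fact i * ((1 - s) gchoose i) * x powr (1 - s - of_nat i) :: complex)"
  define A :: complex where "A = of_nat (Suc n)"
  let ?S = "closed_segment A (A + 1)"
  have S: "\<exists>r. x = of_real r \<and> r \<ge> real (Suc n)" if "x \<in> ?S" for x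
  proof -
    from that obtain u where u: "0 \<le> u" "u \<le> 1" "x = (1 - u) *\<^sub>R A + u *\<^sub>R (A + 1)"
      by (auto simp: closed_segment_def)
    hence "x = of_real (real (Suc n) + u)"
      by (simp add: A_def scaleR_conv_of_real algebra_simps)
    thus ?thesis using u by fastforce
  qed
  have "norm (f 0 (A + 1) - (\<Sum>i\<le>M. f i A * (A + 1 - A) ^ i / fact i))
      \<le> (norm (fact (Suc M) * ((1 - s) gchoose Suc M)) * real (Suc n) powr (- Re s - real M))
          * norm (A + 1 - A) ^ Suc M / fact M"
  proof (rule complex_Taylor[of ?S])
    fix i x assume x: "x \<in> ?S" and "i \<le> M"
    from S[OF x] have "x \<notin> \<real>\<^sub>\<le>\<^sub>0" by (auto simp: complex_nonpos_Reals_iff)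
    have "(f i has_field_derivative
            fact i * ((1 - s) gchoose i) * ((1 - s - of_nat i) * x powr (1 - s - of_nat i - 1))) (at x)"
      unfolding f_def using \<open>x \<notin> \<real>\<^sub>\<le>\<^sub>0\<close>
      by (intro DERIV_cmult has_field_derivative_powr)
    also have "fact i * ((1 - s) gchoose i) * ((1 - s - of_nat i) * x powr (1 - s - of_nat i - 1))
        = fact i * (((1 - s) - of_nat i) * ((1 - s) gchoose i)) * x powr (1 - s - of_nat (Suc i))"
      by (simp add: algebra_simps)
    also have "((1 - s) - of_nat i) * ((1 - s) gchoose i) = of_nat (Suc i) * ((1 - s) gchoose Suc i)"
      using gbinomial_mult_1[of "1 - s" i] by (simp add: algebra_simps)
    also have "fact i * (of_nat (Suc i) * ((1 - s) gchoose Suc i)) * x powr (1 - s - of_nat (Suc i)) = f (Suc i) x"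
      by (simp add: f_def algebra_simps)
    finally show "(f i has_field_derivative f (Suc i) x) (at x within ?S)"
      by (rule has_field_derivative_at_within)
  next
    fix x assume x: "x \<in> ?S"
    from S[OF x] obtain r where r: "x = of_real r" "r \<ge> real (Suc n)" by blast
    have "norm (x powr (1 - s - of_nat (Suc M))) = r powr (- Re s - real M)"
      using r by (subst norm_powr_real_powr) auto
    also have "\<dots> \<le> real (Suc n) powr (- Re s - real M)"
      using r assms by (intro powr_mono2') auto
    finally show "norm (f (Suc M) x) \<le>
        norm (fact (Suc M) * ((1 - s) gchoose Suc M)) * real (Suc n) powr (- Re s - real M)"
      unfolding f_def norm_mult by (intro mult_left_mono) auto
  qed auto
  also have "f 0 (A + 1) - (\<Sum>i\<le>M. f i A * (A + 1 - A) ^ i / fact i) = zeta_rem M n s"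
    by (simp add: f_def A_def zeta_rem_def)
  finally show ?thesis by simp
qed

lemma holomorphic_gbinomial [holomorphic_intros]:
  "f holomorphic_on S \<Longrightarrow> (\<lambda>s. f s gchoose k) holomorphic_on S" for f :: "complex \<Rightarrow> complex"
  unfolding gbinomial_prod_rev by (intro holomorphic_intros) auto

lemma zeta_rem_holomorphic: "zeta_rem M n holomorphic_on S"
proof -
  have *: "(of_nat (Suc n) + 1 :: complex) \<noteq> 0"
    by (metis of_nat_Suc of_nat_neq_0 add.commute)
  show ?thesis
    unfolding zeta_rem_def [abs_def]
    by (intro holomorphic_intros) (use * in \<open>auto simp del: of_nat_Suc\<close>)
qed

lemma zeta_rem_sums:
  obtains E where "E holomorphic_on {s. Re s > 1 - real M}"
    "\<And>s. Re s > 1 - real M \<Longrightarrow> (\<lambda>n. zeta_rem M n s) sums E s"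
proof -
  let ?S = "{s. Re s > 1 - real M}"
  obtain E where E: "\<forall>s\<in>?S. (\<lambda>n. zeta_rem M n s) sums E s \<and> E field_differentiable (at s)"
  proof (rule series_differentiable_comparison_complex[of ?S "zeta_rem M"])
    show "open ?S" by (rule open_halfspace_Re_gt)
    then show "zeta_rem M n field_differentiable (at s)" if "s \<in> ?S" for n s
      using zeta_rem_holomorphic[of M n ?S] that by (meson holomorphic_on_imp_differentiable_at)
  next
    fix z assume z: "z \<in> ?S"
    define d where "d = (Re z - (1 - real M)) / 2"
    have d: "d > 0" using z by (simp add: d_def)
    let ?C = "\<lambda>s::complex. fact (Suc M) * ((1 - s) gchoose Suc M) / fact M"
    have "continuous_on (cball z d) ?C"
      by (intro holomorphic_on_imp_continuous_on holomorphic_intros) auto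
    hence "bounded (?C ` cball z d)"
      by (intro compact_imp_bounded compact_continuous_image) auto
    then obtain B where B: "B > 0" "\<And>s. s \<in> cball z d \<Longrightarrow> norm (?C s) \<le> B"
      unfolding bounded_pos by blast
    define h where "h = (\<lambda>n. of_real (B * real (Suc n) powr (- 1 - d)) :: complex)"
    have "summable (\<lambda>n. real n powr (- 1 - d))"
      using d by (subst summable_real_powr_iff) auto
    hence "summable (\<lambda>n. real (Suc n) powr (- 1 - d))"
      by (subst summable_Suc_iff)
    hence "summable h"
      unfolding h_def by (intro summable_of_real summable_mult)
    moreover have "range h \<subseteq> \<real>\<^sub>\<ge>\<^sub>0"
      using B(1) by (auto simp: h_def complex_nonneg_Reals_iff)
    moreover have "norm (zeta_rem M n s) \<le> norm (h n)" if s: "s \<in> ball z d" for n s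
    proof -
      have "\<bar>Re (z - s)\<bar> \<le> norm (z - s)" by (rule abs_Re_le_cmod)
      also have "\<dots> < d" using s by (simp add: dist_norm)
      finally have Re: "Re s > 1 - real M + d"
        unfolding d_def by (simp add: field_simps abs_if split: if_splits)
      have "norm (zeta_rem M n s) \<le> norm (?C s) * real (Suc n) powr (- Re s - real M)"
        using norm_zeta_rem_le[of s M n] Re d by (simp add: norm_divide norm_mult del: fact_Suc of_nat_Suc)
      also have "\<dots> \<le> B * real (Suc n) powr (- 1 - d)"
        using Re B s by (intro mult_mono powr_mono) auto
      finally show ?thesis using B(1) by (simp add: h_def norm_mult del: of_nat_Suc)
    qed
    ultimately show "\<exists>d h. 0 < d \<and> summable h \<and> range h \<subseteq> \<real>\<^sub>\<ge>\<^sub>0 \<and>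
        (\<forall>\<^sub>F n in sequentially. \<forall>y\<in>ball z d \<inter> ?S. norm (zeta_rem M n y) \<le> cmod (h n))"
      using d by (intro exI[of _ d] exI[of _ h]) auto
  qed
  show ?thesis
  proof (rule that)
    show "E holomorphic_on ?S"
      using E by (auto simp: holomorphic_on_def intro: field_differentiable_at_within)
  qed (use E in auto)
qed

definition dirichlet_zeta :: "complex \<Rightarrow> complex" where
  "dirichlet_zeta s = (\<Sum>n. of_nat (Suc n) powr (- s))"

lemma dirichlet_zeta_sums:
  assumes "Re s > 1"
  shows "(\<lambda>n. of_nat (Suc n) powr (- s)) sums dirichlet_zeta s"
proof -
  have "summable (\<lambda>n. of_nat n powr (- s) :: complex)"
  proof (rule summable_norm_cancel)
    have "summable (\<lambda>n. real n powr (- Re s))"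
      using assms by (subst summable_real_powr_iff) auto
    also have "(\<lambda>n. real n powr (- Re s)) = (\<lambda>n. norm (of_nat n powr (- s) :: complex))"
      by (auto simp: norm_powr_real_powr)
    finally show "summable (\<lambda>n. norm (of_nat n powr (- s) :: complex))" .
  qed
  hence "summable (\<lambda>n. of_nat (Suc n) powr (- s))"
    by (subst summable_Suc_iff)
  thus ?thesis unfolding dirichlet_zeta_def by (rule summable_sums)
qed

lemma dirichlet_zeta_rec:
  assumes s: "Re s > 1"
    and E: "(\<lambda>n. zeta_rem (Suc m) n s) sums E"
  shows "(s - 1) * dirichlet_zeta s =
     1 - (\<Sum>i=1..m. 1 / of_nat (Suc i) * ((1 - s) gchoose i) *
            ((s + of_nat i - 1) * dirichlet_zeta (s + of_nat i))) + E"
proof -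
  have "(\<lambda>n. of_nat n powr (1 - s)) \<longlonglongrightarrow> 0"
    using s by (intro tendsto_neg_powr_complex_of_nat filterlim_ident) auto
  hence "(\<lambda>n. of_nat (Suc n) powr (1 - s)) \<longlonglongrightarrow> 0"
    by (rule LIMSEQ_Suc)
  hence "(\<lambda>n. of_nat (Suc (Suc n)) powr (1 - s) - of_nat (Suc n) powr (1 - s)) sums (0 - of_nat (Suc 0) powr (1 - s))"
    by (rule telescope_sums)
  hence tel: "(\<lambda>n. of_nat (Suc (Suc n)) powr (1 - s) - of_nat (Suc n) powr (1 - s)) sums (- 1)"
    by simp
  have "(\<lambda>n. \<Sum>i\<le>m. ((1 - s) gchoose Suc i) * of_nat (Suc n) powr (- (s + of_nat i))) sums
          (\<Sum>i\<le>m. ((1 - s) gchoose Suc i) * dirichlet_zeta (s + of_nat i))"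
    using s by (intro sums_sum sums_mult dirichlet_zeta_sums) auto
  from sums_diff[OF tel this]
  have "(\<lambda>n. zeta_rem (Suc m) n s) sums
          (- 1 - (\<Sum>i\<le>m. ((1 - s) gchoose Suc i) * dirichlet_zeta (s + of_nat i)))"
    unfolding zeta_rem_def sum.atMost_Suc_shift by (simp add: algebra_simps)
  hence "E = - 1 - (\<Sum>i\<le>m. ((1 - s) gchoose Suc i) * dirichlet_zeta (s + of_nat i))"
    using E sums_unique2 by blast
  also have "(\<Sum>i\<le>m. ((1 - s) gchoose Suc i) * dirichlet_zeta (s + of_nat i)) =
      (1 - s) * dirichlet_zeta s + (\<Sum>i=1..m. ((1 - s) gchoose Suc i) * dirichlet_zeta (s + of_nat i))"
    by (simp add: atMost_atLeast0 sum.atLeast_Suc_atMost)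
  also have "(\<Sum>i=1..m. ((1 - s) gchoose Suc i) * dirichlet_zeta (s + of_nat i)) =
      - (\<Sum>i=1..m. 1 / of_nat (Suc i) * ((1 - s) gchoose i) *
            ((s + of_nat i - 1) * dirichlet_zeta (s + of_nat i)))"
    unfolding sum_negf [symmetric]
  proof (rule sum.cong)
    fix i
    have "((1 - s) - of_nat i) * ((1 - s) gchoose i) = of_nat (Suc i) * ((1 - s) gchoose Suc i)"
      using gbinomial_mult_1[of "1 - s" i] by (simp add: algebra_simps)
    hence eq: "((1 - s) gchoose Suc i) = ((1 - s) - of_nat i) * ((1 - s) gchoose i) / of_nat (Suc i)"
      by (simp add: field_simps del: of_nat_Suc)
    show "((1 - s) gchoose Suc i) * dirichlet_zeta (s + of_nat i) =
        - (1 / of_nat (Suc i) * ((1 - s) gchoose i) * ((s + of_nat i - 1) * dirichlet_zeta (s + of_nat i)))"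
      unfolding eq by (simp add: field_simps del: of_nat_Suc)
  qed simp
  finally show ?thesis by (simp add: algebra_simps)
qed

lemma zeta_halfplane_continuation:
  "\<exists>F. F holomorphic_on {s. Re s > 1 - real m} \<and>
       (\<forall>s. Re s > 1 \<longrightarrow> F s = (s - 1) * dirichlet_zeta s)"
proof (induction m)
  case 0
  obtain E where E: "E holomorphic_on {s. Re s > 1 - real 1}"
    "\<And>s. Re s > 1 - real 1 \<Longrightarrow> (\<lambda>n. zeta_rem 1 n s) sums E s"
    using zeta_rem_sums[of 1] by blast
  show ?case
  proof (intro exI[of _ "\<lambda>s. 1 + E s"] conjI allI impI)
    show "(\<lambda>s. 1 + E s) holomorphic_on {s. Re s > 1 - real 0}"
      by (intro holomorphic_intros holomorphic_on_subset[OF E(1)]) auto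
    show "1 + E s = (s - 1) * dirichlet_zeta s" if "Re s > 1" for s
      using dirichlet_zeta_rec[of s 0 "E s"] E(2)[of s] that by simp
  qed
next
  case (Suc m)
  then obtain F where F: "F holomorphic_on {s. Re s > 1 - real m}"
    "\<And>s. Re s > 1 \<Longrightarrow> F s = (s - 1) * dirichlet_zeta s"
    by blast
  obtain E where E: "E holomorphic_on {s. Re s > 1 - real (Suc m)}"
    "\<And>s. Re s > 1 - real (Suc m) \<Longrightarrow> (\<lambda>n. zeta_rem (Suc m) n s) sums E s"
    using zeta_rem_sums[of "Suc m"] by blast
  define G where "G = (\<lambda>s. 1 - (\<Sum>i=1..m. 1 / of_nat (Suc i) * ((1 - s) gchoose i) * F (s + of_nat i)) + E s)"
  show ?case
  proof (intro exI[of _ G] conjI allI impI)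
    have "(\<lambda>s. F (s + of_nat i)) holomorphic_on {s. Re s > 1 - real (Suc m)}" if "i \<in> {1..m}" for i
    proof -
      have "(F \<circ> (\<lambda>s. s + of_nat i)) holomorphic_on {s. Re s > 1 - real (Suc m)}"
        using that by (intro holomorphic_on_compose_gen[OF _ F(1)] holomorphic_intros) auto
      thus ?thesis by (simp add: o_def)
    qed
    thus "G holomorphic_on {s. Re s > 1 - real (Suc m)}"
      unfolding G_def by (intro holomorphic_intros E(1)) (auto simp del: of_nat_Suc)
    show "G s = (s - 1) * dirichlet_zeta s" if "Re s > 1" for s
    proof -
      have "(\<Sum>i=1..m. 1 / of_nat (Suc i) * ((1 - s) gchoose i) * F (s + of_nat i)) =
            (\<Sum>i=1..m. 1 / of_nat (Suc i) * ((1 - s) gchoose i) *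
              ((s + of_nat i - 1) * dirichlet_zeta (s + of_nat i)))"
        using that by (intro sum.cong refl) (subst F(2), auto)
      thus ?thesis
        using dirichlet_zeta_rec[of s m "E s"] E(2)[of s] that by (simp only: G_def)
    qed
  qed
qed

lemma zeta_spec_ex: "\<exists>f. zeta_spec f"
proof -
  let ?S = "\<lambda>m::nat. {s. Re s > 1 - real m}"
  obtain F where F: "\<And>m. F m holomorphic_on ?S m"
    "\<And>m s. Re s > 1 \<Longrightarrow> F m s = (s - 1) * dirichlet_zeta s"
    using zeta_halfplane_continuation by metis
  have eq: "F m s = F n s" if "m \<le> n" "s \<in> ?S m" for m n s
  proof (rule analytic_continuation_open[of "{s. Re s > 1}" "?S m" "F m" "F n"])
    show "{s. Re s > 1} \<noteq> {}" by (auto intro!: exI[of _ 2])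
    show "connected (?S m)" by (intro convex_connected convex_halfspace_Re_gt)
    show "F n holomorphic_on ?S m" using that by (intro holomorphic_on_subset[OF F(1)]) auto
  qed (use that F in \<open>auto intro: open_halfspace_Re_gt\<close>)
  define k where "k = (\<lambda>s. nat \<lceil>1 - Re s\<rceil> + 1)"
  have k: "s \<in> ?S (k s)" for s unfolding k_def by simp linarith
  define G where "G = (\<lambda>s. F (k s) s)"
  have G: "G s = F m s" if "s \<in> ?S m" for m s
    using eq[of m "k s" s] eq[of "k s" m s] k[of s] that unfolding G_def by (metis nat_le_linear)
  have "G holomorphic_on (\<Union>m. ?S m)"
  proof (rule holomorphic_on_UN_open)
    show "G holomorphic_on ?S m" for m
      by (subst holomorphic_cong[OF refl G]) (auto intro: F(1))
  qed (rule open_halfspace_Re_gt)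
  also have "(\<Union>m. ?S m) = UNIV" using k by blast
  finally have hol: "G holomorphic_on - {1}" by (rule holomorphic_on_subset) auto
  have "zeta_spec (\<lambda>s. if s = 1 then 0 else G s / (s - 1))"
    unfolding zeta_spec_def
  proof (intro conjI allI impI)
    show "(\<lambda>s. if s = 1 then 0 else G s / (s - 1)) holomorphic_on - {1}"
      by (rule holomorphic_transform[of "\<lambda>s. G s / (s - 1)"]) (auto intro!: holomorphic_intros hol)
    fix s assume s: "Re s > 1"
    hence "G s = (s - 1) * dirichlet_zeta s" using G[of s 0] F(2) by simp
    hence "(if s = 1 then 0 else G s / (s - 1)) = dirichlet_zeta s" using s by auto
    thus "(\<lambda>n. 1 / of_nat (Suc n) powr s) sums (if s = 1 then 0 else G s / (s - 1))"
      using dirichlet_zeta_sums[OF s] by (simp add: powr_minus_divide)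
  qed simp
  thus ?thesis by blast
qed

lemma zeta_spec_ex1: "\<exists>!f. zeta_spec f"
  using zeta_spec_ex zeta_spec_unique by blast

lemma zeta_spec_zeta: "zeta_spec zeta"
  unfolding zeta_def by (rule theI'[OF zeta_spec_ex1])

lemma zeta_holomorphic: "zeta holomorphic_on - {1}"
  and zeta_sums: "Re s > 1 \<Longrightarrow> (\<lambda>n. 1 / of_nat (Suc n) powr s) sums zeta s"
  using zeta_spec_zeta by (auto simp: zeta_spec_def)

end

theory Submission
  imports Defs
begin

text \<open>
  The partial sums \<open>\<phi>\<^sub>N\<close> converge locally uniformly on \<open>Re s > 0\<close> to
  \<open>\<eta>(s) = (1 - 2\<^sup>1\<^sup>-\<^sup>s) \<zeta>(s)\<close>, whose zeros with \<open>0 < Re s < 1\<close> are those of \<open>\<zeta>\<close>. If \<open>\<eta>\<close> has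
  no zero in a compact disc, then \<open>\<phi>\<^sub>N\<close> has none for large \<open>N\<close>; conversely, if infinitely many
  \<open>\<phi>\<^sub>N\<close> have no zero in the disc, then by Hurwitz's theorem \<open>\<eta>\<close> has none in its interior. Zeros
  left of the critical line are reflected to the right of it by the functional equation.

  Both the convergence and the functional equation come from the Mellin transform
  \<open>\<Gamma>(s + 1) \<eta>(s) = \<integral> x\<^sup>s k(x) dx\<close> over \<open>x > 0\<close>, where \<open>k(x) = e\<^sup>x / (e\<^sup>x + 1)\<^sup>2\<close> is smooth at \<open>0\<close>, so
  that the integral converges for \<open>Re s > -1\<close> without any continuation. Truncating the expansion of
  \<open>k\<close> in powers of \<open>e\<^sup>-\<^sup>x\<close> gives \<open>\<phi>\<^sub>N\<close>, while the partial fraction expansion of \<open>k\<close> gives a multiple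
  of \<open>\<zeta>(1 - s)\<close> for \<open>-1 < Re s < 0\<close>. Only the implication from \<open>\<zeta>(1 - s) = 0\<close> to \<open>\<zeta>(s) = 0\<close> is
  needed, so the integral that appears as the other factor need not be evaluated.
\<close>

subsection \<open>The Mellin transform\<close>

text \<open>The exponent is \<open>s\<close> instead of the customary \<open>s - 1\<close>.\<close>

definition mellin :: "(real \<Rightarrow> real) \<Rightarrow> complex \<Rightarrow> complex" where
  "mellin g s = (LINT x:{0<..}|lborel. of_real x powr s * of_real (g x))"

lemma set_integrable_mellin:
  assumes "g \<in> borel_measurable borel" "set_integrable lborel {0<..} (\<lambda>x. x powr Re s * g x)"
  shows "set_integrable lborel {0<..} (\<lambda>x. of_real x powr s * complex_of_real (g x))"
  unfolding set_integrable_def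
proof (rule Bochner_Integration.integrable_bound)
  show "integrable lborel (\<lambda>x. indicator {0<..} x *\<^sub>R (x powr Re s * g x))"
    using assms(2) unfolding set_integrable_def .
  show "(\<lambda>x. indicator {0<..} x *\<^sub>R (of_real x powr s * complex_of_real (g x))) \<in> borel_measurable lborel"
    using assms(1) by measurable
  show "AE x in lborel. norm (indicator {0<..} x *\<^sub>R (of_real x powr s * complex_of_real (g x)))
          \<le> norm (indicator {0<..} x *\<^sub>R (x powr Re s * g x))"
    by (auto simp: indicator_def norm_mult norm_powr_real_powr abs_mult)
qed

text \<open>Only the integral over \<open>S - A\<close> is lost, and \<open>h\<close> dominates
  \<open>f\<close> there. The bound involves \<open>h\<close> alone, so it is uniform over all
  \<open>f\<close> with this majorant.\<close>

lemma norm_set_integral_diff_le: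
  fixes f :: "real \<Rightarrow> complex"
  assumes f: "set_integrable lborel S f" and h: "set_integrable lborel S h"
    and le: "\<And>x. x \<in> S \<Longrightarrow> norm (f x) \<le> h x" and A: "A \<subseteq> S" "A \<in> sets lborel" "S \<in> sets lborel"
  shows "norm ((LINT x:A|lborel. f x) - (LINT x:S|lborel. f x)) \<le>
           (LINT x:S|lborel. h x) - (LINT x:A|lborel. h x)"
proof -
  have split: "(LINT x:S|lborel. k x) = (LINT x:A|lborel. k x) + (LINT x:S-A|lborel. k x)"
    if "set_integrable lborel S k" for k :: "real \<Rightarrow> 'b::{banach, second_countable_topology}"
  proof -
    have "set_integrable lborel A k" "set_integrable lborel (S - A) k"
      using that A by (auto intro: set_integrable_subset)
    from set_integral_Un[OF _ this] show ?thesis using A(1) by (simp add: Un_absorb1)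
  qed
  have fd: "set_integrable lborel (S - A) f" and hd: "set_integrable lborel (S - A) h"
    using f h A by (auto intro: set_integrable_subset)
  have "norm (LINT x:S-A|lborel. f x) \<le> (LINT x:S-A|lborel. norm (f x))"
    using fd by (rule set_integral_norm_bound)
  also have "\<dots> \<le> (LINT x:S-A|lborel. h x)"
    using fd hd le by (intro set_integral_mono set_integrable_norm) auto
  finally show ?thesis
    unfolding split[OF f] split[OF h] by simp
qed

text \<open>Integrals over compact subintervals are entire by differentiation under the integral
  sign, and they converge locally uniformly to \<open>mellin g\<close>.\<close>

lemma mellin_holomorphic:
  assumes g: "continuous_on UNIV g" and T: "open T"
    and int: "\<And>\<sigma>. \<sigma> \<in> T \<Longrightarrow> set_integrable lborel {0<..} (\<lambda>x. x powr \<sigma> * g x)"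
  shows "mellin g holomorphic_on {s. Re s \<in> T}"
proof -
  have meas: "g \<in> borel_measurable borel"
    using g by (rule borel_measurable_continuous_onI)
  \<comment> \<open>The intervals exhaust the positive axis but stay away from 0, so the integrand
    and its derivative in \<open>s\<close>, which contains \<open>Ln\<close>, are continuous on
    each.\<close>
  define A where "A = (\<lambda>n::nat. {1 / real (Suc n)..real (Suc n)})"
  define F where "F = (\<lambda>n s. LINT x:A n|lborel. of_real x powr s * complex_of_real (g x))"
  have A_pos: "x > 0" if "x \<in> A n" for x n
    using that unfolding A_def by (auto intro: less_le_trans[of 0 "1 / real (Suc n)"])
  have A_mono: "A i \<subseteq> A (Suc i)" for i
    by (auto simp: A_def field_simps)
  have A_Un: "(\<Union>n. A n) = {0<..}"
  proof (intro equalityI subsetI)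
    fix x :: real assume x: "x \<in> {0<..}"
    obtain n where n: "real n > max x (1 / x)" using reals_Archimedean2 by blast
    hence "x \<in> A n" using x unfolding A_def by (auto simp: field_simps)
    thus "x \<in> (\<Union>n. A n)" by blast
  qed (use A_pos in auto)
  have F_hol: "F n holomorphic_on {s. Re s \<in> T}" for n
  proof -
    let ?f = "\<lambda>s x. of_real x powr s * complex_of_real (g x)"
    have cont: "continuous_on (A n) (?f s)" for s
      using A_pos[of _ n] by (intro continuous_intros continuous_on_subset[OF g]) (auto simp: complex_nonpos_Reals_iff less_imp_le)
    have "(\<lambda>s. integral (cbox (1 / real (Suc n)) (real (Suc n))) (?f s)) holomorphic_on UNIV"
    proof (rule leibniz_rule_holomorphic[where fx = "\<lambda>s x. Ln (of_real x) * of_real x powr s * complex_of_real (g x)"])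
      fix s :: complex and t assume "t \<in> cbox (1 / real (Suc n)) (real (Suc n))"
      hence "t > 0" using A_pos[of t n] by (simp add: A_def)
      thus "((\<lambda>s. ?f s t) has_field_derivative Ln (of_real t) * of_real t powr s * complex_of_real (g t)) (at s within UNIV)"
        by (auto intro!: derivative_eq_intros simp: powr_def)
    next
      show "?f s integrable_on cbox (1 / real (Suc n)) (real (Suc n))" for s
        using integrable_continuous_interval[OF cont[of s, unfolded A_def]] by simp
    next
      have "continuous_on (UNIV \<times> A n) (\<lambda>p. Ln (of_real (snd p)) * of_real (snd p) powr fst p * complex_of_real (g (snd p)))"
        by (intro continuous_intros continuous_on_compose2[OF g])
           (auto simp: complex_nonpos_Reals_iff dest: A_pos)
      thus "continuous_on (UNIV \<times> cbox (1 / real (Suc n)) (real (Suc n)))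
              (\<lambda>(s, x). Ln (of_real x) * of_real x powr s * complex_of_real (g x))"
        by (simp add: A_def case_prod_unfold)
    qed auto
    moreover have "integral (cbox (1 / real (Suc n)) (real (Suc n))) (?f s) = F n s" for s
    proof -
      have "set_integrable lborel (A n) (?f s)"
        using cont[of s] unfolding A_def by (intro borel_integrable_atLeastAtMost') auto
      from set_borel_integral_eq_integral(2)[OF this] show ?thesis
        by (simp add: F_def A_def)
    qed
    ultimately show ?thesis by (auto intro: holomorphic_on_subset)
  qed
  show ?thesis
  proof (rule holomorphic_uniform_sequence[OF _ F_hol])
    show "open {s. Re s \<in> T}"
      using open_vimage[OF T, of Re] by (simp add: vimage_def continuous_on_Re continuous_on_id)
    fix z assume "z \<in> {s. Re s \<in> T}"
    then obtain e where e: "e > 0" "cball (Re z) e \<subseteq> T"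
      using T by (auto simp: open_contains_cball)
    have Re_mem: "\<bar>Re s - Re z\<bar> \<le> e" if "s \<in> cball z e" for s
      using that abs_Re_le_cmod[of "s - z"] by (simp add: dist_norm norm_minus_commute)
    \<comment> \<open>One majorant for the whole disc: the lower extreme exponent dominates for
      \<open>x \<le> 1\<close> and the upper one for \<open>x > 1\<close>.\<close>
    define h where "h = (\<lambda>x. \<bar>x powr (Re z - e) * g x\<bar> + \<bar>x powr (Re z + e) * g x\<bar>)"
    have "Re z - e \<in> T" "Re z + e \<in> T"
      using e by (auto simp: subset_iff dist_norm)
    hence h: "set_integrable lborel {0<..} h"
      unfolding h_def by (intro set_integral_add set_integrable_abs int)
    have bound: "norm (F n s - mellin g s) \<le> (LINT x:{0<..}|lborel. h x) - (LINT x:A n|lborel. h x)"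
      if s: "s \<in> cball z e" for s n
      unfolding F_def mellin_def
    proof (rule norm_set_integral_diff_le)
      have "Re s \<in> T"
        using Re_mem[OF s] e(2) by (auto simp: subset_iff dist_norm abs_minus_commute)
      thus "set_integrable lborel {0<..} (\<lambda>x. of_real x powr s * complex_of_real (g x))"
        by (intro set_integrable_mellin meas int)
      fix x :: real assume x: "x \<in> {0<..}"
      have "x powr Re s \<le> x powr (Re z - e) + x powr (Re z + e)"
      proof (cases "x \<le> 1")
        case True
        hence "x powr Re s \<le> x powr (Re z - e)"
          using x Re_mem[OF s] by (intro powr_mono') auto
        thus ?thesis by (simp add: add_increasing2)
      next
        case False
        hence "x powr Re s \<le> x powr (Re z + e)"
          using x Re_mem[OF s] by (intro powr_mono) auto
        thus ?thesis by (simp add: add_increasing)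
      qed
      hence "x powr Re s * \<bar>g x\<bar> \<le> (x powr (Re z - e) + x powr (Re z + e)) * \<bar>g x\<bar>"
        by (rule mult_right_mono) auto
      thus "norm (of_real x powr s * complex_of_real (g x)) \<le> h x"
        using x by (simp add: h_def norm_mult norm_powr_real_powr abs_mult algebra_simps)
    qed (use h A_pos in \<open>auto simp: A_def\<close>)
    \<comment> \<open>The \<open>A n\<close> increase to the positive axis, so the right-hand side
      of \<open>bound\<close>, which does not depend on \<open>s\<close>, tends to 0.\<close>
    have lim: "(\<lambda>n. LINT x:A n|lborel. h x) \<longlonglongrightarrow> (LINT x:{0<..}|lborel. h x)"
      using set_integral_cont_up[of A lborel h] A_mono h unfolding A_Un
      by (auto simp: A_def incseq_Suc_iff)
    have "uniform_limit (cball z e) F (mellin g) sequentially"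
    proof (rule uniform_limitI)
      fix d :: real assume "d > 0"
      from tendstoD[OF lim this]
      show "\<forall>\<^sub>F n in sequentially. \<forall>s\<in>cball z e. dist (F n s) (mellin g s) < d"
      proof eventually_elim
        case (elim n)
        show ?case
          using bound[of _ n] elim by (fastforce simp: dist_norm)
      qed
    qed
    moreover have "cball z e \<subseteq> {s. Re s \<in> T}"
      using Re_mem e(2) by (auto simp: subset_iff dist_norm abs_minus_commute)
    ultimately show "\<exists>d>0. cball z d \<subseteq> {s. Re s \<in> T} \<and> uniform_limit (cball z d) F (mellin g) sequentially"
      using e(1) by blast
  qed
qed

section \<open>Scaling and majorants\<close>

lemma set_integral_pos_scale:
  fixes h :: "real \<Rightarrow> 'a :: {banach, second_countable_topology}"
  assumes a: "a > 0"
  shows "(LINT x:{0<..}|lborel. h (x / a)) = a *\<^sub>R (LINT x:{0<..}|lborel. h x)"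
proof -
  have "(LINT x:{0<..}|lborel. h (x / a)) =
        \<bar>a\<bar> *\<^sub>R (\<integral>x. indicator {0<..} (0 + a * x) *\<^sub>R h ((0 + a * x) / a) \<partial>lborel)"
    unfolding set_lebesgue_integral_def using a by (intro lborel_integral_real_affine) auto
  also have "(\<lambda>x. indicator {0<..} (0 + a * x) *\<^sub>R h ((0 + a * x) / a)) = (\<lambda>x. indicator {0<..} x *\<^sub>R h x)"
    using a by (auto simp: fun_eq_iff indicator_def zero_less_mult_iff)
  finally show ?thesis using a by (simp add: set_lebesgue_integral_def)
qed

lemma set_integrable_pos_scale:
  fixes h :: "real \<Rightarrow> 'a :: {banach, second_countable_topology}"
  assumes a: "a > 0" and h: "set_integrable lborel {0<..} h"
  shows "set_integrable lborel {0<..} (\<lambda>x. h (x / a))"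
proof -
  have "integrable lborel (\<lambda>x. indicator {0<..} (0 + inverse a * x) *\<^sub>R h (0 + inverse a * x))"
    using a h unfolding set_integrable_def by (intro lborel_integrable_real_affine) auto
  also have "(\<lambda>x. indicator {0<..} (0 + inverse a * x) *\<^sub>R h (0 + inverse a * x)) =
             (\<lambda>x. indicator {0<..} x *\<^sub>R h (x / a))"
    using a by (auto simp: fun_eq_iff indicator_def zero_less_mult_iff field_simps)
  finally show ?thesis by (simp add: set_integrable_def)
qed

lemma set_integrable_powr_scale:
  fixes a \<sigma> :: real
  assumes a: "a > 0" and g: "set_integrable lborel {0<..} (\<lambda>x. x powr \<sigma> * g x)"
  shows "set_integrable lborel {0<..} (\<lambda>x. x powr \<sigma> * g (x / a))"
proof -
  have "set_integrable lborel {0<..} (\<lambda>x. a powr \<sigma> * ((x / a) powr \<sigma> * g (x / a)))"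
    by (intro set_integrable_mult_right set_integrable_pos_scale[where h = "\<lambda>x. x powr \<sigma> * g x"] a g)
  also have "?this \<longleftrightarrow> ?thesis"
    using a by (intro set_integrable_cong) (auto simp: powr_divide)
  finally show ?thesis .
qed

text \<open>The power contributes \<open>a powr s\<close> and the differential one further factor
  \<open>a\<close>. Scaled copies of one kernel thus yield the terms of a Dirichlet series.\<close>

lemma mellin_scale:
  assumes a: "a > 0"
  shows "mellin (\<lambda>x. g (x / a)) s = of_real a powr (s + 1) * mellin g s"
proof -
  have "mellin (\<lambda>x. g (x / a)) s =
        (LINT x:{0<..}|lborel. of_real a powr s * (of_real (x / a) powr s * complex_of_real (g (x / a))))"
    unfolding mellin_def
  proof (rule set_lebesgue_integral_cong)
    have "of_real x powr s = of_real a powr s * of_real (x / a) powr s" if "x > 0" for x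
    proof -
      have "complex_of_real x = of_real a * of_real (x / a)" using a by simp
      also have "\<dots> powr s = of_real a powr s * of_real (x / a) powr s"
        using a that by (intro powr_times_real) auto
      finally show ?thesis .
    qed
    thus "\<forall>x. x \<in> {0<..} \<longrightarrow> of_real x powr s * complex_of_real (g (x / a)) =
        of_real a powr s * (of_real (x / a) powr s * complex_of_real (g (x / a)))" by simp
  qed auto
  also have "\<dots> = of_real a powr s * (LINT x:{0<..}|lborel. of_real (x / a) powr s * complex_of_real (g (x / a)))"
    by simp
  also have "\<dots> = of_real a powr s * (a *\<^sub>R mellin g s)"
    unfolding mellin_def
    using set_integral_pos_scale[OF a, of "\<lambda>x. of_real x powr s * complex_of_real (g x)"] by simp
  finally show ?thesis
    using a by (simp add: powr_add scaleR_conv_of_real)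
qed

text \<open>The integral of the majorant is stated as a value of \<open>mellin\<close> at the real
  point \<open>Re s\<close>, so that closed forms found for complex arguments also evaluate error
  bounds.\<close>

lemma norm_mellin_le:
  assumes g: "g \<in> borel_measurable borel"
    and h: "set_integrable lborel {0<..} (\<lambda>x. x powr Re s * h x)"
    and le: "\<And>x. x > 0 \<Longrightarrow> \<bar>g x\<bar> \<le> h x"
  shows "norm (mellin g s) \<le> Re (mellin h (of_real (Re s)))"
    and "set_integrable lborel {0<..} (\<lambda>x. x powr Re s * g x)"
proof -
  show int: "set_integrable lborel {0<..} (\<lambda>x. x powr Re s * g x)"
  proof (rule set_integrable_bound[OF h])
    show "set_borel_measurable lborel {0<..} (\<lambda>x. x powr Re s * g x)"
      using g unfolding set_borel_measurable_def by measurable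
    have "norm (x powr Re s * g x) \<le> norm (x powr Re s * h x)" if "x > 0" for x
      using le[OF that] by (simp add: abs_mult mult_left_mono)
    thus "AE x in lborel. x \<in> {0<..} \<longrightarrow> norm (x powr Re s * g x) \<le> norm (x powr Re s * h x)"
      by auto
  qed
  have int': "set_integrable lborel {0<..} (\<lambda>x. of_real x powr s * complex_of_real (g x))"
    by (rule set_integrable_mellin[OF g int])
  have "norm (mellin g s) \<le> (LINT x:{0<..}|lborel. norm (of_real x powr s * complex_of_real (g x)))"
    unfolding mellin_def using int' by (rule set_integral_norm_bound)
  also have "\<dots> \<le> (LINT x:{0<..}|lborel. x powr Re s * h x)"
    using le by (intro set_integral_mono set_integrable_norm int' h)
      (auto simp: norm_mult norm_powr_real_powr mult_left_mono)
  also have "complex_of_real \<dots> = mellin h (of_real (Re s))"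
    unfolding mellin_def set_integral_complex_of_real[symmetric]
    by (intro set_lebesgue_integral_cong) (auto simp: powr_of_real)
  hence "(LINT x:{0<..}|lborel. x powr Re s * h x) = Re (mellin h (of_real (Re s)))"
    by (metis Re_complex_of_real)
  finally show "norm (mellin g s) \<le> Re (mellin h (of_real (Re s)))" .
qed

section \<open>Exponential kernels and linearity\<close>

lemma fixes \<sigma> :: real
  shows mellin_exp_minus: "Re s > -1 \<Longrightarrow> mellin (\<lambda>x. exp (- x)) s = Gamma (s + 1)"
  and set_integrable_powr_exp_minus: "\<sigma> > -1 \<Longrightarrow> set_integrable lborel {0<..} (\<lambda>x. x powr \<sigma> * exp (- x))"
proof -
  have int: "set_integrable lborel {0<..} (\<lambda>x. of_real x powr s * complex_of_real (exp (- x)))"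
    if "Re s > -1" for s
  proof -
    have "(\<lambda>t. complex_of_real t powr (s + 1 - 1) / of_real (exp t)) absolutely_integrable_on {0<..}"
      using that by (intro absolutely_integrable_Gamma_integral') auto
    hence "set_integrable lborel {0<..} (\<lambda>t. complex_of_real t powr (s + 1 - 1) / of_real (exp t))"
      unfolding set_integrable_def by (subst (asm) integrable_completion) measurable
    thus ?thesis by (simp add: exp_minus field_simps)
  qed
  show "mellin (\<lambda>x. exp (- x)) s = Gamma (s + 1)" if "Re s > -1"
  proof -
    have "mellin (\<lambda>x. exp (- x)) s = integral {0<..} (\<lambda>x. of_real x powr s * complex_of_real (exp (- x)))"
      unfolding mellin_def by (intro set_borel_integral_eq_integral(2) int that)
    also have "\<dots> = integral {0<..} (\<lambda>t. complex_of_real t powr (s + 1 - 1) / of_real (exp t))"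
      by (simp add: exp_minus field_simps)
    also have "\<dots> = Gamma (s + 1)"
      using that by (intro integral_unique Gamma_integral_complex') auto
    finally show ?thesis .
  qed
  show "set_integrable lborel {0<..} (\<lambda>x. x powr \<sigma> * exp (- x))" if "\<sigma> > -1"
  proof -
    have "set_integrable lborel {0<..} (\<lambda>x. norm (of_real x powr of_real \<sigma> * complex_of_real (exp (- x))))"
      using that by (intro set_integrable_norm int) auto
    also have "?this \<longleftrightarrow> ?thesis"
      by (intro set_integrable_cong) (auto simp: norm_mult norm_powr_real_powr)
    finally show ?thesis .
  qed
qed

lemma mellin_exp_mult_minus:
  assumes "Re s > -1" "a > 0"
  shows "mellin (\<lambda>x. exp (- a * x)) s = Gamma (s + 1) / of_real a powr (s + 1)"
proof -
  have "mellin (\<lambda>x. exp (- a * x)) s = of_real (1 / a) powr (s + 1) * Gamma (s + 1)"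
    using mellin_scale[of "1 / a" "\<lambda>x. exp (- x)" s] assms by (simp add: mellin_exp_minus mult.commute)
  also have "of_real (1 / a) powr (s + 1) = 1 / complex_of_real a powr (s + 1)"
    using powr_times_real[of "of_real (1 / a)" "of_real a" "s + 1"] assms by (simp add: field_simps)
  finally show ?thesis by simp
qed

lemma set_integrable_powr_exp_mult_minus:
  fixes a \<sigma> :: real
  assumes "\<sigma> > -1" "a > 0"
  shows "set_integrable lborel {0<..} (\<lambda>x. x powr \<sigma> * exp (- a * x))"
  using set_integrable_powr_scale[of "1 / a" \<sigma> "\<lambda>x. exp (- x)"] assms set_integrable_powr_exp_minus[of \<sigma>]
  by (simp add: mult.commute)

lemma mellin_cmult: "mellin (\<lambda>x. c * g x) s = of_real c * mellin g s"
  by (simp add: mellin_def mult.left_commute)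

lemma mellin_diff:
  assumes "set_integrable lborel {0<..} (\<lambda>x. of_real x powr s * complex_of_real (f x))"
    and "set_integrable lborel {0<..} (\<lambda>x. of_real x powr s * complex_of_real (g x))"
  shows "mellin (\<lambda>x. f x - g x) s = mellin f s - mellin g s"
  using set_integral_diff(2)[OF assms] by (simp add: mellin_def algebra_simps)

lemma mellin_sum:
  assumes "\<And>i. i \<in> I \<Longrightarrow> set_integrable lborel {0<..} (\<lambda>x. of_real x powr s * complex_of_real (g i x))"
  shows "mellin (\<lambda>x. \<Sum>i\<in>I. g i x) s = (\<Sum>i\<in>I. mellin (g i) s)"
    and "set_integrable lborel {0<..} (\<lambda>x. of_real x powr s * complex_of_real (\<Sum>i\<in>I. g i x))"
  using Bochner_Integration.integral_sum[OF assms[unfolded set_integrable_def], of I]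
    Bochner_Integration.integrable_sum[OF assms[unfolded set_integrable_def], of I]
  by (simp_all add: mellin_def set_lebesgue_integral_def set_integrable_def sum_distrib_left scaleR_sum_right)

subsection \<open>The two kernels\<close>

text \<open>The derivative of the logistic function \<open>exp x / (exp x + 1)\<close>; this is the
  kernel \<open>k\<close> of the overview.\<close>

definition logistic_deriv :: "real \<Rightarrow> real" where
  "logistic_deriv x = exp x / (exp x + 1) ^ 2"

text \<open>The real part of \<open>1 / (1 + \<i> u)^2\<close>, which arises when conjugate terms of
  the partial fraction expansion are added.\<close>

definition rat_kernel :: "real \<Rightarrow> real" where
  "rat_kernel u = (1 - u ^ 2) / (1 + u ^ 2) ^ 2"

section \<open>Continuity and integrability of the kernels\<close>

lemma continuous_logistic_deriv: "continuous_on UNIV logistic_deriv"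
proof -
  have "exp x + 1 \<noteq> 0" for x :: real by (smt (verit) exp_gt_zero)
  thus ?thesis unfolding logistic_deriv_def [abs_def] by (intro continuous_intros) auto
qed

lemma continuous_rat_kernel: "continuous_on UNIV rat_kernel"
proof -
  have "1 + x\<^sup>2 \<noteq> 0" for x :: real by (smt (verit) zero_le_power2)
  thus ?thesis unfolding rat_kernel_def [abs_def] by (intro continuous_intros) auto
qed

lemma set_integrable_powr_logistic_deriv:
  assumes "\<sigma> > -1"
  shows "set_integrable lborel {0<..} (\<lambda>x. x powr \<sigma> * logistic_deriv x)"
proof -
  have "\<bar>logistic_deriv x\<bar> \<le> exp (- x)" for x
  proof -
    have "exp x * exp x \<le> (exp x + 1) ^ 2" by (simp add: power2_eq_square algebra_simps)
    thus ?thesis by (simp add: logistic_deriv_def exp_minus divide_simps)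
  qed
  thus ?thesis
    using norm_mellin_le(2)[of logistic_deriv "of_real \<sigma>" "\<lambda>x. exp (- x)"] assms
      set_integrable_powr_exp_minus[of \<sigma>] borel_measurable_continuous_onI[OF continuous_logistic_deriv]
    by simp
qed

text \<open>Since \<open>1 - u^2\<close> is at most \<open>1 + u^2\<close> in absolute value,
  \<open>1 / (1 + u^2)\<close> is a common majorant for both estimates.\<close>

lemma abs_rat_kernel_le: "\<bar>rat_kernel u\<bar> \<le> 1" "\<bar>rat_kernel u\<bar> \<le> u powr (-2)" if "u > 0"
proof -
  have le: "\<bar>1 - u ^ 2\<bar> * (1 + u ^ 2) \<le> (1 + u ^ 2) * (1 + u ^ 2)"
    using that by (intro mult_right_mono) (auto simp: abs_if)
  have pos: "1 + u ^ 2 > 0" by (simp add: add_pos_nonneg)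
  have "\<bar>rat_kernel u\<bar> = \<bar>1 - u ^ 2\<bar> / (1 + u ^ 2) ^ 2" by (simp add: rat_kernel_def)
  also have "\<dots> \<le> 1 / (1 + u ^ 2)"
    using le pos by (simp add: divide_simps power2_eq_square)
  finally have *: "\<bar>rat_kernel u\<bar> \<le> 1 / (1 + u ^ 2)" .
  also have "\<dots> \<le> 1" using pos by (simp add: divide_simps)
  finally show "\<bar>rat_kernel u\<bar> \<le> 1" .
  have "1 / (1 + u ^ 2) \<le> 1 / u ^ 2" using that by (intro divide_left_mono) (auto intro!: mult_pos_pos pos)
  also have "\<dots> = u powr (-2)" using that by (simp add: powr_minus divide_inverse powr_numeral)
  finally show "\<bar>rat_kernel u\<bar> \<le> u powr (-2)" using * by simp
qed

text \<open>On \<open>{0<..1}\<close> the kernel is bounded by 1, which requires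
  \<open>\<sigma> > -1\<close>; on \<open>{1..}\<close> it is bounded by \<open>x powr (-2)\<close>,
  which requires \<open>\<sigma> < 1\<close>.\<close>

lemma set_integrable_powr_rat_kernel:
  assumes "-1 < \<sigma>" "\<sigma> < 1"
  shows "set_integrable lborel {0<..} (\<lambda>x. x powr \<sigma> * rat_kernel x)"
proof -
  have meas: "rat_kernel \<in> borel_measurable borel"
    by (rule borel_measurable_continuous_onI[OF continuous_rat_kernel])
  have *: "set_integrable lborel A (\<lambda>x. x powr \<sigma> * rat_kernel x)"
    if "(\<lambda>x. x powr \<tau>) integrable_on A" "A \<in> sets borel"
      "\<And>x. x \<in> A \<Longrightarrow> \<bar>x powr \<sigma> * rat_kernel x\<bar> \<le> x powr \<tau>" for A \<tau>
  proof -
    have "(\<lambda>x. x powr \<tau>) absolutely_integrable_on A"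
      using that(1) by (subst absolutely_integrable_on_iff_nonneg) auto
    hence "set_integrable lborel A (\<lambda>x. x powr \<tau>)"
      unfolding set_integrable_def using that(2) by (subst (asm) integrable_completion) auto
    thus ?thesis
    proof (rule set_integrable_bound)
      show "set_borel_measurable lborel A (\<lambda>x. x powr \<sigma> * rat_kernel x)"
        using meas that(2) unfolding set_borel_measurable_def by measurable
    qed (use that(3) in auto)
  qed
  have "set_integrable lborel {0<..1} (\<lambda>x. x powr \<sigma> * rat_kernel x)"
  proof (rule *)
    show "(\<lambda>x. x powr \<sigma>) integrable_on {0<..1}"
      using assms by (intro integrable_on_powr_from_0') auto
    show "\<bar>x powr \<sigma> * rat_kernel x\<bar> \<le> x powr \<sigma>" if "x \<in> {0<..1}" for x
      using mult_left_mono[OF abs_rat_kernel_le(1)[of x], of "x powr \<sigma>"] that by (simp add: abs_mult)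
  qed auto
  moreover have "set_integrable lborel {1..} (\<lambda>x. x powr \<sigma> * rat_kernel x)"
  proof (rule *)
    show "(\<lambda>x. x powr (\<sigma> + (-2))) integrable_on {1..}"
      using has_integral_powr_to_inf[of "\<sigma> + (-2)" 1] assms by (auto simp: integrable_on_def)
    show "\<bar>x powr \<sigma> * rat_kernel x\<bar> \<le> x powr (\<sigma> + (-2))" if "x \<in> {1..}" for x
      using mult_left_mono[OF abs_rat_kernel_le(2)[of x], of "x powr \<sigma>"] that
      unfolding powr_add by (simp add: abs_mult)
  qed auto
  ultimately have "set_integrable lborel ({0<..1} \<union> {1..}) (\<lambda>x. x powr \<sigma> * rat_kernel x)"
    by (rule set_integrable_Un) auto
  also have "{0<..1} \<union> {1..} = {(0::real)<..}" by auto
  finally show ?thesis .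
qed

text \<open>With \<open>q = exp (- x)\<close>, the kernel is \<open>q / (1 + q)^2\<close>, the full
  alternating sum of \<open>n q^n\<close> when \<open>q < 1\<close>. The exact remainder after
  \<open>N\<close> terms is verified by induction.\<close>

lemma alternating_exp_sum_diff:
  "(\<Sum>n=1..N. (-1) ^ (n - 1) * (real n * exp (- real n * x))) - logistic_deriv x =
     - ((-1) ^ N * exp (- real (Suc N) * x) * ((real (Suc N) + real N * exp (- x)) / (1 + exp (- x)) ^ 2))"
proof -
  define q where "q = exp (- x)"
  have q: "q > 0" by (simp add: q_def)
  have pow: "exp (- real n * x) = q ^ n" for n
    by (simp add: q_def flip: exp_of_nat_mult)
  have nz: "1 + q \<noteq> 0" using q by linarith
  have "logistic_deriv x = q / (1 + q) ^ 2"
    using nz q unfolding logistic_deriv_def q_def exp_minus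
    by (simp add: divide_simps power2_eq_square)
  moreover have "(\<Sum>n=1..N. (-1) ^ (n - 1) * (real n * q ^ n)) =
      q / (1 + q) ^ 2 - (-1) ^ N * q ^ Suc N * ((real (Suc N) + real N * q) / (1 + q) ^ 2)"
  proof (induction N)
    case (Suc N)
    show ?case
      unfolding sum.cl_ivl_Suc Suc.IH using nz
      by (simp add: divide_simps) (simp add: algebra_simps power2_eq_square)
  qed (use nz in simp)
  ultimately show ?thesis
    unfolding pow q_def[symmetric] by simp
qed

text \<open>The error is at most the first omitted term. As \<open>n exp (- n x)\<close> need not
  decrease in \<open>n\<close>, this is read off the exact remainder and not from the alternating
  series criterion.\<close>

lemma norm_alternating_exp_sum_le:
  assumes "x > 0"
  shows "\<bar>(\<Sum>n=1..N. (-1) ^ (n - 1) * (real n * exp (- real n * x))) - logistic_deriv x\<bar> \<le>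
           real (Suc N) * exp (- real (Suc N) * x)"
proof -
  define q where "q = exp (- x)"
  have q: "q > 0" by (simp add: q_def)
  have "real (Suc N) + real N * q \<le> real (Suc N) * (1 + q) * (1 + q)"
    using q by (simp add: algebra_simps add_nonneg_nonneg)
  hence "(real (Suc N) + real N * q) / (1 + q) ^ 2 \<le> real (Suc N)"
    using q by (simp add: divide_simps power2_eq_square mult_ac del: of_nat_Suc)
  hence "exp (- real (Suc N) * x) * ((real (Suc N) + real N * q) / (1 + q) ^ 2)
         \<le> exp (- real (Suc N) * x) * real (Suc N)"
    by (intro mult_left_mono) auto
  thus ?thesis
    unfolding alternating_exp_sum_diff q_def[symmetric] using q
    by (simp add: abs_mult mult_ac del: of_nat_Suc)
qed

text \<open>The reflection formula of \<open>Gamma\<close> is differentiated logarithmically, which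
  gives \<open>Digamma\<close>, and then once more. As \<open>Polygamma 1\<close> is a series of
  inverse squares, this expands the right-hand side in partial fractions.\<close>

lemma trigamma_reflection:
  fixes z :: complex
  assumes "z \<notin> \<int>"
  shows "Polygamma 1 z + Polygamma 1 (1 - z) = (of_real pi / sin (of_real pi * z)) ^ 2"
proof -
  have sin_nz: "sin (of_real pi * w) \<noteq> 0" if "w \<notin> \<int>" for w :: complex
    using that by (auto simp: sin_eq_0 mult.commute)
  have nonpos: "w \<notin> \<int>\<^sub>\<le>\<^sub>0" "1 - w \<notin> \<int>\<^sub>\<le>\<^sub>0" if "w \<notin> \<int>" for w :: complex
    using that nonpos_Ints_Int Ints_diff[of 1 "1 - w"] by force+
  have opn: "open (- \<int> :: complex set)"
    by (intro open_Compl closed_Ints)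
  have digamma: "Digamma w - Digamma (1 - w) = - of_real pi * cos (of_real pi * w) / sin (of_real pi * w)"
    if w: "w \<notin> \<int>" for w :: complex
  proof -
    note [simp] = sin_nz[OF w]
    let ?G = "\<lambda>w::complex. Gamma w * Gamma (1 - w)"
    have G: "?G w = of_real pi / sin (of_real pi * w)"
      by (rule Gamma_reflection_complex)
    \<comment> \<open>The product is differentiated twice over: factor by factor here, and in its
      closed form below.\<close>
    have "(?G has_field_derivative ?G w * (Digamma w - Digamma (1 - w))) (at w)"
      using nonpos[OF w] by (auto intro!: derivative_eq_intros simp: algebra_simps)
    moreover have "(?G has_field_derivative
        - of_real pi * (cos (of_real pi * w) * of_real pi) / sin (of_real pi * w) ^ 2) (at w)"
      unfolding Gamma_reflection_complex
      by (auto intro!: derivative_eq_intros simp: power2_eq_square)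
    ultimately have "?G w * (Digamma w - Digamma (1 - w)) =
        - of_real pi * (cos (of_real pi * w) * of_real pi) / sin (of_real pi * w) ^ 2"
      by (rule DERIV_unique)
    hence "sin (of_real pi * w) / of_real pi * (?G w * (Digamma w - Digamma (1 - w))) =
        sin (of_real pi * w) / of_real pi *
        (- of_real pi * (cos (of_real pi * w) * of_real pi) / sin (of_real pi * w) ^ 2)"
      by (simp only:)
    thus ?thesis
      unfolding G by (simp add: power2_eq_square)
  qed
  note [simp] = sin_nz[OF assms] sin_nz[OF assms, unfolded mult.commute[of _ z]]
  have "((\<lambda>w. Digamma w - Digamma (1 - w)) has_field_derivative
           Polygamma 1 z + Polygamma 1 (1 - z)) (at z)"
    using nonpos[OF assms] by (auto intro!: derivative_eq_intros)
  \<comment> \<open>\<open>digamma\<close> holds on the open complement of the integers, hence near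
    \<open>z\<close>, so the derivative carries over.\<close>
  hence "((\<lambda>w. - of_real pi * cos (of_real pi * w) / sin (of_real pi * w)) has_field_derivative
           Polygamma 1 z + Polygamma 1 (1 - z)) (at z)"
    by (rule has_field_derivative_transform_within_open[OF _ opn]) (use assms digamma in auto)
  moreover have "((\<lambda>w. - of_real pi * cos (of_real pi * w) / sin (of_real pi * w)) has_field_derivative
      of_real pi * of_real pi * (sin (of_real pi * z) * sin (of_real pi * z) +
        cos (of_real pi * z) * cos (of_real pi * z)) / (sin (of_real pi * z) * sin (of_real pi * z))) (at z)"
    by (auto intro!: derivative_eq_intros simp: field_simps simp del: sin_cos_squared_add3)
  ultimately have "Polygamma 1 z + Polygamma 1 (1 - z) =
      of_real pi * of_real pi * (sin (of_real pi * z) * sin (of_real pi * z) +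
        cos (of_real pi * z) * cos (of_real pi * z)) / (sin (of_real pi * z) * sin (of_real pi * z))"
    by (rule DERIV_unique)
  thus ?thesis
    using sin_cos_squared_add[of "of_real pi * z"] by (simp add: power2_eq_square)
qed

text \<open>
  This is \<open>\<pi>\<^sup>2 / sin\<^sup>2 (\<pi> z) = \<Sum> 1 / (z + n)\<^sup>2\<close> over all integers \<open>n\<close>, at \<open>z = 1/2 + \<i> x / (2 \<pi>)\<close>, with the
  terms of \<open>k\<close> and \<open>-k - 1\<close> combined.
\<close>

lemma logistic_deriv_partial_fractions:
  fixes x :: real
  defines "a \<equiv> \<lambda>k::nat. real (2 * k + 1) * pi"
  shows "(\<lambda>k. 2 / a k ^ 2 * rat_kernel (x / a k)) sums logistic_deriv x"
proof -
  define z where "z = Complex (1/2) (x / (2 * pi))"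
  have z1: "1 - z = Complex (1/2) (- x / (2 * pi))"
    by (simp add: z_def complex_eq_iff)
  have zint: "z \<notin> \<int>"
  proof
    assume "z \<in> \<int>"
    then obtain n where "z = of_int n" by (elim Ints_cases)
    hence "real_of_int (2 * n) = real_of_int 1" by (simp add: z_def complex_eq_iff)
    hence "2 * n = 1" by (simp only: of_int_eq_iff)
    thus False by presburger
  qed
  have nz: "z \<noteq> 0" "1 - z \<noteq> 0" using zint by auto
  have a_pos: "a k > 0" for k unfolding a_def by (simp add: add_pos_nonneg)
  have "(\<lambda>k. inverse ((z + of_nat k)\<^sup>2) + inverse ((1 - z + of_nat k)\<^sup>2)) sums
          (Polygamma 1 z + Polygamma 1 (1 - z))"
    using sums_add[OF Polygamma_LIMSEQ[OF nz(1), of 1] Polygamma_LIMSEQ[OF nz(2), of 1]]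
    by (simp add: numeral_2_eq_2)
  also have "Polygamma 1 z + Polygamma 1 (1 - z) = (of_real pi / sin (of_real pi * z)) ^ 2"
    by (rule trigamma_reflection[OF zint])
  also have "of_real pi * z = of_real pi / 2 + \<i> * of_real (x / 2)"
    by (simp add: z_def complex_eq_iff)
  \<comment> \<open>The quarter-period shift turns the sine into \<open>cosh (x / 2)\<close>, and
    \<open>1 / cosh (x / 2)^2\<close> is four times the kernel.\<close>
  also have "sin (of_real pi / 2 + \<i> * of_real (x / 2)) = cos (\<i> * complex_of_real (x / 2))"
    by (simp add: sin_add)
  also have "cos (\<i> * complex_of_real (x / 2)) = of_real ((exp (x / 2) + exp (- (x / 2))) / 2)"
    by (simp add: cos_exp_eq add_ac flip: exp_of_real)
  also have "(of_real pi / of_real ((exp (x / 2) + exp (- (x / 2))) / 2) :: complex)\<^sup>2 =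
             of_real (4 * pi ^ 2 * logistic_deriv x)"
  proof -
    define e where "e = exp (x / 2)"
    have e: "e > 0" "exp x = e ^ 2" "exp (- (x / 2)) = 1 / e"
      by (auto simp: e_def exp_minus field_simps simp flip: exp_double)
    have "e\<^sup>2 + 1 > 0" by (simp add: add_nonneg_pos)
    hence "(pi / ((e + 1 / e) / 2)) ^ 2 = 4 * pi ^ 2 * (e ^ 2 / (e ^ 2 + 1) ^ 2)"
      using e(1) by (simp add: field_simps power2_eq_square)
    thus ?thesis unfolding logistic_deriv_def e e_def[symmetric]
      by (metis of_real_divide of_real_power)
  qed
  also have "(\<lambda>k. inverse ((z + of_nat k)\<^sup>2) + inverse ((1 - z + of_nat k)\<^sup>2)) =
             (\<lambda>k. of_real (4 * pi ^ 2 * (2 / a k ^ 2 * rat_kernel (x / a k))))"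
  proof
    fix k
    \<comment> \<open>Up to the factor \<open>2 * pi\<close> the two terms have the conjugate bases
      \<open>c + y\<close> and \<open>c - y\<close>, so their inverse squares add up to
      \<open>2 (c^2 + y^2) / (c^2 - y^2)^2\<close>, where \<open>y^2 = - x^2\<close>.\<close>
    define c where "c = complex_of_real (a k)"
    define y where "y = \<i> * complex_of_real x"
    have 1: "z + of_nat k = (c + y) / (2 * of_real pi)"
      by (simp add: z_def c_def y_def a_def complex_eq_iff Re_divide Im_divide field_simps power2_eq_square)
    have 2: "1 - z + of_nat k = (c - y) / (2 * of_real pi)"
      unfolding z1 by (simp add: c_def y_def a_def complex_eq_iff Re_divide Im_divide field_simps power2_eq_square)
    have nz: "c + y \<noteq> 0" "c - y \<noteq> 0" "c \<noteq> 0" "c\<^sup>2 - y\<^sup>2 \<noteq> 0"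
      using a_pos[of k] by (auto simp: c_def y_def complex_eq_iff square_diff_square_factored power2_eq_square)
    have "rat_kernel (x / a k) = a k ^ 2 * (a k ^ 2 - x ^ 2) / (a k ^ 2 + x ^ 2) ^ 2"
    proof -
      have "a k ^ 2 + x ^ 2 > 0" using a_pos[of k] by (simp add: add_pos_nonneg)
      thus ?thesis using a_pos[of k] unfolding rat_kernel_def
        by (simp add: divide_simps power2_eq_square)
    qed
    hence "of_real (4 * pi ^ 2 * (2 / a k ^ 2 * rat_kernel (x / a k))) =
        of_real (2 * pi) ^ 2 * (2 * (c\<^sup>2 + y\<^sup>2) / (c\<^sup>2 - y\<^sup>2) ^ 2)"
      using a_pos[of k] by (simp add: c_def y_def power_mult_distrib)
    also have "\<dots> = inverse ((z + of_nat k)\<^sup>2) + inverse ((1 - z + of_nat k)\<^sup>2)"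
      unfolding 1 2 using nz by (simp add: divide_simps power2_eq_square) (simp add: algebra_simps)
    finally show "inverse ((z + of_nat k)\<^sup>2) + inverse ((1 - z + of_nat k)\<^sup>2) =
       of_real (4 * pi ^ 2 * (2 / a k ^ 2 * rat_kernel (x / a k)))" ..
  qed
  finally have "(\<lambda>k. 4 * pi ^ 2 * (2 / a k ^ 2 * rat_kernel (x / a k))) sums (4 * pi ^ 2 * logistic_deriv x)"
    by (simp only: sums_of_real_iff)
  thus ?thesis by (subst (asm) sums_mult_iff) simp_all
qed

subsection \<open>The alternating zeta function\<close>

text \<open>Each term \<open>(-1)^(n-1) n exp (- n x)\<close> has Mellin transform
  \<open>Gamma (s + 1) (-1)^(n-1) / n powr s\<close>, so truncating the kernel truncates the
  Dirichlet series. The error is the transform of the first omitted term in absolute value.\<close>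

lemma norm_Gamma_phi_diff_le:
  assumes s: "Re s > -1"
  shows "norm (Gamma (s + 1) * phi N s - mellin logistic_deriv s) \<le>
           Gamma (Re s + 1) * real (Suc N) powr (- Re s)"
proof -
  define e where "e = (\<lambda>n x. (-1) ^ (n - 1) * (real n * exp (- real n * x)))"
  have meas [measurable]: "logistic_deriv \<in> borel_measurable borel"
    by (rule borel_measurable_continuous_onI[OF continuous_logistic_deriv])
  have int_exp: "set_integrable lborel {0<..} (\<lambda>x. x powr \<sigma> * (c * exp (- real n * x)))"
    if "\<sigma> > -1" "n > 0" for n and c \<sigma> :: real
  proof -
    have "set_integrable lborel {0<..} (\<lambda>x. c * (x powr \<sigma> * exp (- real n * x)))"
      using that by (intro set_integrable_mult_right set_integrable_powr_exp_mult_minus) auto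
    thus ?thesis by (simp add: mult.left_commute)
  qed
  have int_e: "set_integrable lborel {0<..} (\<lambda>x. of_real x powr s * complex_of_real (e n x))"
    if "n \<in> {1..N}" for n
  proof (rule set_integrable_mellin)
    show "set_integrable lborel {0<..} (\<lambda>x. x powr Re s * e n x)"
      using int_exp[of "Re s" n "(-1) ^ (n - 1) * real n"] s that by (simp add: e_def mult_ac)
  qed (simp add: e_def)
  have int_k: "set_integrable lborel {0<..} (\<lambda>x. of_real x powr s * complex_of_real (logistic_deriv x))"
    using s by (intro set_integrable_mellin set_integrable_powr_logistic_deriv meas)
  have mellin_e: "mellin (e n) s = Gamma (s + 1) * ((-1) ^ (n - 1) / of_nat n powr s)" if "n \<in> {1..N}" for n
  proof -
    have "mellin (e n) s = (-1) ^ (n - 1) * (of_nat n * mellin (\<lambda>x. exp (- real n * x)) s)"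
      unfolding e_def by (simp only: mellin_cmult) simp
    also have "mellin (\<lambda>x. exp (- real n * x)) s = Gamma (s + 1) / of_nat n powr (s + 1)"
      using that s by (subst mellin_exp_mult_minus) auto
    finally show ?thesis using that by (simp add: powr_add)
  qed
  have "Gamma (s + 1) * phi N s - mellin logistic_deriv s = (\<Sum>n=1..N. mellin (e n) s) - mellin logistic_deriv s"
    by (simp add: phi_def sum_distrib_left mellin_e)
  also have "(\<Sum>n=1..N. mellin (e n) s) = mellin (\<lambda>x. \<Sum>n=1..N. e n x) s"
    by (rule mellin_sum(1)[OF int_e, symmetric])
  also have "\<dots> - mellin logistic_deriv s = mellin (\<lambda>x. (\<Sum>n=1..N. e n x) - logistic_deriv x) s"
    by (intro mellin_diff[symmetric] mellin_sum(2) int_e int_k)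
  also have "norm \<dots> \<le> Re (mellin (\<lambda>x. real (Suc N) * exp (- real (Suc N) * x)) (of_real (Re s)))"
  proof (rule norm_mellin_le(1))
    show "set_integrable lborel {0<..} (\<lambda>x. x powr Re s * (real (Suc N) * exp (- real (Suc N) * x)))"
      using s by (intro int_exp) auto
    show "\<bar>(\<Sum>n=1..N. e n x) - logistic_deriv x\<bar> \<le> real (Suc N) * exp (- real (Suc N) * x)"
      if "x > 0" for x
      using norm_alternating_exp_sum_le[OF that, of N] by (simp add: e_def)
  qed (simp add: e_def)
  also have "mellin (\<lambda>x. real (Suc N) * exp (- real (Suc N) * x)) (of_real (Re s)) =
             of_nat (Suc N) * (Gamma (of_real (Re s) + 1) / of_nat (Suc N) powr (of_real (Re s) + 1))"
    unfolding mellin_cmult using s by (subst mellin_exp_mult_minus) auto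
  also have "\<dots> = Gamma (of_real (Re s + 1)) * of_real (real (Suc N)) powr of_real (- Re s)"
    by (simp add: powr_add powr_minus field_simps del: of_nat_Suc)
  also have "\<dots> = of_real (Gamma (Re s + 1) * real (Suc N) powr (- Re s))"
    by (simp only: powr_of_real[OF of_nat_0_le_iff] Gamma_complex_of_real of_real_mult)
  finally show ?thesis by simp
qed

text \<open>The Dirichlet eta function. Dividing by \<open>Gamma (s + 1)\<close> is written with the
  entire function \<open>rGamma\<close>, so that holomorphy is inherited from the integral.\<close>

definition eta :: "complex \<Rightarrow> complex" where
  "eta s = rGamma (s + 1) * mellin logistic_deriv s"

lemma Gamma_mult_eta: "Re s > -1 \<Longrightarrow> Gamma (s + 1) * eta s = mellin logistic_deriv s"
proof -
  assume "Re s > -1"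
  hence "s + 1 \<notin> \<int>\<^sub>\<le>\<^sub>0" by (auto elim!: nonpos_Ints_cases simp: complex_eq_iff)
  thus ?thesis by (simp add: eta_def rGamma_inverse_Gamma Gamma_eq_zero_iff)
qed

lemma holomorphic_eta: "eta holomorphic_on {s. Re s > -1}"
proof -
  have "mellin logistic_deriv holomorphic_on {s. Re s \<in> {-1<..}}"
    using continuous_logistic_deriv set_integrable_powr_logistic_deriv by (intro mellin_holomorphic) auto
  thus ?thesis
    unfolding eta_def [abs_def] by (intro holomorphic_intros) auto
qed

text \<open>On \<open>K\<close> the error is a continuous, hence bounded, factor times
  \<open>real (Suc N) powr (- Re s)\<close>, and \<open>Re s\<close> has a positive minimum
  there.\<close>

lemma uniform_limit_phi:
  assumes K: "compact K" "K \<subseteq> {s. Re s > 0}"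
  shows "uniform_limit K phi eta sequentially"
proof (cases "K = {}")
  case False
  have "continuous_on K Re" by (intro continuous_intros)
  then obtain s0 where s0: "s0 \<in> K" "\<And>s. s \<in> K \<Longrightarrow> Re s0 \<le> Re s"
    using continuous_attains_inf[OF K(1) False, of Re] by blast
  define \<delta> where "\<delta> = Re s0"
  have \<delta>: "\<delta> > 0" using s0 K by (auto simp: \<delta>_def)
  \<comment> \<open>The complex \<open>Gamma\<close> at a real point replaces the real one of the
    estimate, so that the whole factor is a continuous complex function.\<close>
  let ?C = "\<lambda>s. rGamma (s + 1) * Gamma (complex_of_real (Re s) + 1)"
  have "complex_of_real (Re s) + 1 \<notin> \<int>\<^sub>\<le>\<^sub>0" if "s \<in> K" for s
    using that K by (auto elim!: nonpos_Ints_cases simp: complex_eq_iff)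
  hence "continuous_on K ?C"
    by (intro continuous_at_imp_continuous_on ballI continuous_intros) auto
  hence "bounded (?C ` K)"
    by (intro compact_imp_bounded compact_continuous_image K)
  then obtain B where B: "B > 0" "\<And>s. s \<in> K \<Longrightarrow> norm (?C s) \<le> B"
    unfolding bounded_pos by blast
  have bound: "norm (phi N s - eta s) \<le> B * real (Suc N) powr (- \<delta>)" if s: "s \<in> K" for s N
  proof -
    have Re: "Re s > 0" "Re s \<ge> \<delta>" using s s0 K by (auto simp: \<delta>_def)
    hence "s + 1 \<notin> \<int>\<^sub>\<le>\<^sub>0" by (auto elim!: nonpos_Ints_cases simp: complex_eq_iff)
    hence "phi N s - eta s = rGamma (s + 1) * (Gamma (s + 1) * phi N s - mellin logistic_deriv s)"
      by (simp add: eta_def rGamma_inverse_Gamma Gamma_eq_zero_iff algebra_simps)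
    also have "norm \<dots> \<le> norm (rGamma (s + 1)) * (Gamma (Re s + 1) * real (Suc N) powr (- Re s))"
      unfolding norm_mult using Re by (intro mult_left_mono norm_Gamma_phi_diff_le) auto
    also have "\<dots> \<le> norm (rGamma (s + 1)) * (norm (Gamma (complex_of_real (Re s) + 1)) * real (Suc N) powr (- \<delta>))"
    proof (intro mult_left_mono mult_mono powr_mono)
      have "complex_of_real (Re s) + 1 = of_real (Re s + 1)" by simp
      also have "Gamma \<dots> = of_real (Gamma (Re s + 1))" by (rule Gamma_complex_of_real)
      finally show "Gamma (Re s + 1) \<le> norm (Gamma (complex_of_real (Re s) + 1))"
        by simp
    qed (use Re in auto)
    also have "\<dots> = norm (?C s) * real (Suc N) powr (- \<delta>)" by (simp add: norm_mult)
    also have "\<dots> \<le> B * real (Suc N) powr (- \<delta>)"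
      using B(2)[OF s] by (intro mult_right_mono) auto
    finally show ?thesis .
  qed
  have "(\<lambda>N. real (Suc N) powr (- \<delta>)) \<longlonglongrightarrow> 0"
    using \<delta> by (intro tendsto_neg_powr filterlim_compose[OF filterlim_real_sequentially filterlim_Suc]) auto
  hence lim: "(\<lambda>N. B * real (Suc N) powr (- \<delta>)) \<longlonglongrightarrow> 0"
    by (rule tendsto_mult_right_zero)
  show ?thesis
  proof (rule uniform_limitI)
    fix e :: real assume "e > 0"
    from order_tendstoD(2)[OF lim this]
    show "\<forall>\<^sub>F N in sequentially. \<forall>s\<in>K. dist (phi N s) (eta s) < e"
    proof eventually_elim
      case (elim N)
      thus ?case using bound[of _ N] by (auto simp: dist_norm intro: le_less_trans)
    qed
  qed
qed simp

section \<open>Comparison with the zeta function\<close>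

lemma phi_tendsto_eta: "Re s > 0 \<Longrightarrow> (\<lambda>N. phi N s) \<longlonglongrightarrow> eta s"
  using tendsto_uniform_limitI[OF uniform_limit_phi[of "{s}"], of s] by simp

lemma even_partial_sums_zeta:
  assumes "Re s > 1"
  shows "(\<lambda>N. \<Sum>n<N. 1 / of_nat (2 * Suc n) powr s) \<longlonglongrightarrow> 2 powr (- s) * zeta s"
proof -
  have "(2 * of_nat (Suc n)) powr s = 2 powr s * of_nat (Suc n) powr s" for n
    by (rule powr_times_real) auto
  hence *: "1 / of_nat (2 * Suc n) powr s = 2 powr (- s) * (1 / of_nat (Suc n) powr s)" for n
    unfolding of_nat_mult of_nat_numeral by (simp add: powr_minus field_simps del: of_nat_Suc)
  show ?thesis
    unfolding * sums_def[symmetric] by (intro sums_mult zeta_sums assms)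
qed

lemma double_partial_sums_zeta:
  assumes "Re s > 1"
  shows "(\<lambda>N. \<Sum>n<2*N. 1 / of_nat (Suc n) powr s) \<longlonglongrightarrow> zeta s"
  using LIMSEQ_subseq_LIMSEQ[OF zeta_sums[OF assms, unfolded sums_def], of "\<lambda>N. 2 * N"]
  by (simp add: o_def strict_mono_def)

text \<open>The first \<open>2 * N\<close> terms of \<open>zeta\<close> minus the \<open>N\<close>
  even ones leave the odd ones. This series appears when the partial fractions are
  integrated.\<close>

lemma odd_sums_zeta:
  assumes "Re s > 1"
  shows "(\<lambda>n. 1 / of_nat (2 * n + 1) powr s) sums ((1 - 2 powr (- s)) * zeta s)"
proof -
  have eq: "(\<Sum>n<N. 1 / of_nat (2 * n + 1) powr s) =
      (\<Sum>n<2*N. 1 / of_nat (Suc n) powr s) - (\<Sum>n<N. 1 / of_nat (2 * Suc n) powr s)" for N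
    by (induction N) simp_all
  show ?thesis
    unfolding sums_def eq left_diff_distrib mult_1
    by (intro tendsto_diff double_partial_sums_zeta even_partial_sums_zeta assms)
qed

text \<open>An alternating sum is the full sum minus twice its even part. The partial sums of even
  length suffice, because all of \<open>phi\<close> already converges to \<open>eta\<close>.\<close>

lemma eta_eq_zeta_right_halfplane:
  assumes "Re s > 1"
  shows "eta s = (1 - 2 powr (1 - s)) * zeta s"
proof (rule LIMSEQ_unique)
  have eq: "phi (2 * N) s =
      (\<Sum>n<2*N. 1 / of_nat (Suc n) powr s) - 2 * (\<Sum>n<N. 1 / of_nat (2 * Suc n) powr s)" for N
    by (induction N) (simp_all add: phi_def)
  have "(\<lambda>N. phi (2 * N) s) \<longlonglongrightarrow> zeta s - 2 * (2 powr (- s) * zeta s)"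
    unfolding eq by (intro tendsto_diff tendsto_mult_left double_partial_sums_zeta even_partial_sums_zeta assms)
  also have "zeta s - 2 * (2 powr (- s) * zeta s) = (1 - 2 powr (1 - s)) * zeta s"
    by (simp add: algebra_simps powr_diff powr_minus divide_inverse)
  finally show "(\<lambda>N. phi (2 * N) s) \<longlonglongrightarrow> (1 - 2 powr (1 - s)) * zeta s" .
  show "(\<lambda>N. phi (2 * N) s) \<longlonglongrightarrow> eta s"
    using LIMSEQ_subseq_LIMSEQ[OF phi_tendsto_eta, of s "\<lambda>N. 2 * N"] assms
    by (simp add: o_def strict_mono_def)
qed

text \<open>Analytic continuation from \<open>Re s > 1\<close> in the half-plane punctured at the
  pole of \<open>zeta\<close>, which is still connected.\<close>

lemma eta_eq_zeta:
  assumes "Re s > -1" "s \<noteq> 1"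
  shows "eta s = (1 - 2 powr (1 - s)) * zeta s"
proof (rule analytic_continuation_open[of "{s. Re s > 1}" "{s. Re s > -1} - {1}" eta _ s])
  show "{s. Re s > 1} \<noteq> {}" by (auto intro!: exI[of _ 2])
  show "connected ({s. Re s > -1} - {1::complex})"
    by (intro connected_open_delete open_halfspace_Re_gt convex_connected convex_halfspace_Re_gt) auto
  show "(\<lambda>s. (1 - 2 powr (1 - s)) * zeta s) holomorphic_on {s. Re s > -1} - {1}"
    by (intro holomorphic_intros holomorphic_on_subset[OF zeta_holomorphic]) auto
  show "eta holomorphic_on {s. Re s > -1} - {1}"
    by (rule holomorphic_on_subset[OF holomorphic_eta]) auto
qed (use assms eta_eq_zeta_right_halfplane in \<open>auto intro!: open_halfspace_Re_gt open_delete\<close>)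

subsection \<open>The functional equation\<close>

text \<open>The partial fractions are integrated term by term. By scaling, the term for
  \<open>a k\<close> gives \<open>2 * a k powr (s - 1)\<close> times the transform of
  \<open>rat_kernel\<close>, and the \<open>a k\<close> are the odd multiples of \<open>pi\<close>.
  The sum converges absolutely because \<open>Re s < 0\<close>.\<close>

lemma mellin_logistic_deriv_eq_left_strip:
  assumes s: "-1 < Re s" "Re s < 0"
  shows "mellin logistic_deriv s =
           2 * of_real pi powr (s - 1) * ((1 - 2 powr (s - 1)) * zeta (1 - s)) * mellin rat_kernel s"
proof -
  define a where "a = (\<lambda>k::nat. real (2 * k + 1) * pi)"
  define f where "f = (\<lambda>k x. indicator {0<..} x *\<^sub>R
    (of_real x powr s * complex_of_real (2 / a k ^ 2 * rat_kernel (x / a k))))"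
  define R where "R = (LINT x:{0<..}|lborel. x powr Re s * \<bar>rat_kernel x\<bar>)"
  have a_pos: "a k > 0" for k
    unfolding a_def by (simp add: add_pos_nonneg)
  have a_powr: "a k powr \<sigma> = real (2 * k + 1) powr \<sigma> * pi powr \<sigma>" for k \<sigma>
    unfolding a_def by (rule powr_mult)
  have meas [measurable]: "rat_kernel \<in> borel_measurable borel"
    by (rule borel_measurable_continuous_onI[OF continuous_rat_kernel])
  have int: "set_integrable lborel {0<..} (\<lambda>x. x powr Re s * rat_kernel x)"
    using s by (intro set_integrable_powr_rat_kernel) auto
  have "(\<lambda>k. integral\<^sup>L lborel (f k)) sums (\<integral>x. (\<Sum>k. f k x) \<partial>lborel)"
  proof (rule sums_integral)
    fix k
    have "set_integrable lborel {0<..} (\<lambda>x. 2 / a k ^ 2 * (x powr Re s * rat_kernel (x / a k)))"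
      by (intro set_integrable_mult_right set_integrable_powr_scale a_pos int)
    hence "set_integrable lborel {0<..} (\<lambda>x. x powr Re s * (2 / a k ^ 2 * rat_kernel (x / a k)))"
      by (simp add: mult.left_commute)
    thus "integrable lborel (f k)"
      unfolding f_def set_integrable_def[symmetric] by (intro set_integrable_mellin) measurable
  next
    \<comment> \<open>For fixed \<open>x\<close> the bound
      \<open>\<bar>rat_kernel\<bar> \<le> 1\<close> leaves the coefficients
      \<open>2 / a k ^ 2\<close>, which are summable.\<close>
    have "summable (\<lambda>k. norm (f k x))" for x
    proof (cases "x > 0")
      case True
      have "summable (\<lambda>k. x powr Re s * (2 / pi ^ 2 * real (Suc k) powr (-2)))"
        using summable_real_powr_iff[of "-2"] by (intro summable_mult) (subst summable_Suc_iff, simp)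
      thus ?thesis
      proof (rule summable_comparison_test_ev[rotated], intro always_eventually allI)
        fix k
        have "2 / a k ^ 2 * \<bar>rat_kernel (x / a k)\<bar> \<le> 2 / a k ^ 2 * 1"
          using True a_pos[of k] by (intro mult_left_mono abs_rat_kernel_le) auto
        also have "\<dots> = 2 / pi ^ 2 * real (2 * k + 1) powr (-2)"
          by (simp add: a_def power_mult_distrib powr_minus powr_numeral divide_inverse del: of_nat_add of_nat_mult)
        also have "\<dots> \<le> 2 / pi ^ 2 * real (Suc k) powr (-2)"
          by (intro mult_left_mono powr_mono2') auto
        finally have "2 / a k ^ 2 * \<bar>rat_kernel (x / a k)\<bar> \<le> 2 / pi ^ 2 * real (Suc k) powr (-2)" .
        hence "x powr Re s * (2 / a k ^ 2 * \<bar>rat_kernel (x / a k)\<bar>)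
               \<le> x powr Re s * (2 / pi ^ 2 * real (Suc k) powr (-2))"
          by (rule mult_left_mono) auto
        also have "x powr Re s * (2 / a k ^ 2 * \<bar>rat_kernel (x / a k)\<bar>) = norm (f k x)"
          using True by (simp add: f_def norm_mult norm_divide norm_power norm_powr_real_powr)
        finally show "norm (norm (f k x)) \<le> x powr Re s * (2 / pi ^ 2 * real (Suc k) powr (-2))"
          by simp
      qed
    qed (simp add: f_def)
    thus "AE x in lborel. summable (\<lambda>k. norm (f k x))" by simp
  next
    \<comment> \<open>The same scaling evaluates the norms exactly; the exponent
      \<open>Re s - 1\<close> is below -1, so they are summable.\<close>
    have "(\<integral>x. norm (f k x) \<partial>lborel) = 2 * R * a k powr (Re s - 1)" for k
    proof -
      have "(\<integral>x. norm (f k x) \<partial>lborel) =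
          (LINT x:{0<..}|lborel. 2 / a k ^ 2 * a k powr Re s * ((x / a k) powr Re s * \<bar>rat_kernel (x / a k)\<bar>))"
        unfolding set_lebesgue_integral_def f_def using a_pos[of k]
        by (intro Bochner_Integration.integral_cong)
           (auto simp: indicator_def norm_mult norm_divide norm_power norm_powr_real_powr powr_divide)
      also have "\<dots> = 2 / a k ^ 2 * a k powr Re s *
          (LINT x:{0<..}|lborel. (x / a k) powr Re s * \<bar>rat_kernel (x / a k)\<bar>)"
        by (rule set_integral_mult_right)
      also have "\<dots> = 2 / a k ^ 2 * a k powr Re s * (a k * R)"
        unfolding R_def
        by (subst set_integral_pos_scale[OF a_pos, of "\<lambda>x. x powr Re s * \<bar>rat_kernel x\<bar>"]) simp
      also have "\<dots> = 2 * R * a k powr (Re s - 1)"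
        using a_pos[of k] by (simp add: powr_diff power2_eq_square field_simps)
      finally show ?thesis .
    qed
    moreover have "summable (\<lambda>k. a k powr (Re s - 1))"
    proof -
      have "summable (\<lambda>k. real (Suc k) powr (Re s - 1))"
        using s summable_real_powr_iff[of "Re s - 1"] by (subst summable_Suc_iff) simp
      hence "summable (\<lambda>k. real (2 * k + 1) powr (Re s - 1))"
        by (rule summable_comparison_test_ev[rotated], intro always_eventually allI)
           (use s in \<open>auto intro!: powr_mono2'\<close>)
      thus ?thesis unfolding a_powr by (rule summable_mult2)
    qed
    ultimately show "summable (\<lambda>k. \<integral>x. norm (f k x) \<partial>lborel)"
      by (simp add: summable_mult)
  qed
  also have "(\<integral>x. (\<Sum>k. f k x) \<partial>lborel) = mellin logistic_deriv s"
  proof -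
    have "(\<Sum>k. f k x) = indicator {0<..} x *\<^sub>R (of_real x powr s * complex_of_real (logistic_deriv x))" for x
      unfolding f_def a_def
      by (intro sums_unique[symmetric] sums_scaleR_right sums_mult sums_of_real logistic_deriv_partial_fractions)
    thus ?thesis by (simp add: mellin_def set_lebesgue_integral_def)
  qed
  also have "(\<lambda>k. integral\<^sup>L lborel (f k)) =
     (\<lambda>k. 2 * of_real pi powr (s - 1) * (1 / of_nat (2 * k + 1) powr (1 - s)) * mellin rat_kernel s)"
  proof
    fix k
    have nz: "complex_of_real (a k) \<noteq> 0" using a_pos[of k] by simp
    have "integral\<^sup>L lborel (f k) = mellin (\<lambda>x. 2 / a k ^ 2 * rat_kernel (x / a k)) s"
      by (simp only: f_def mellin_def set_lebesgue_integral_def)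
    also have "\<dots> = of_real (2 / a k ^ 2) * (of_real (a k) powr (s + 1) * mellin rat_kernel s)"
      by (simp only: mellin_cmult mellin_scale[OF a_pos])
    also have "\<dots> = 2 * of_real (a k) powr (s - 1) * mellin rat_kernel s"
      using nz by (simp add: powr_diff powr_add power2_eq_square field_simps)
    also have "complex_of_real (a k) = of_nat (2 * k + 1) * of_real pi"
      by (simp add: a_def)
    also have "\<dots> powr (s - 1) = of_nat (2 * k + 1) powr (s - 1) * of_real pi powr (s - 1)"
      by (rule powr_times_real) auto
    also have "of_nat (2 * k + 1) powr (s - 1) = 1 / complex_of_nat (2 * k + 1) powr (1 - s)"
      by (metis minus_diff_eq powr_minus_divide)
    finally show "integral\<^sup>L lborel (f k) =
       2 * of_real pi powr (s - 1) * (1 / of_nat (2 * k + 1) powr (1 - s)) * mellin rat_kernel s"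
      by (simp only: mult_ac)
  qed
  finally have "(\<lambda>k. 2 * of_real pi powr (s - 1) * (1 / of_nat (2 * k + 1) powr (1 - s)) * mellin rat_kernel s)
      sums mellin logistic_deriv s" .
  moreover have "(\<lambda>k. 2 * of_real pi powr (s - 1) * (1 / of_nat (2 * k + 1) powr (1 - s)) * mellin rat_kernel s)
      sums (2 * of_real pi powr (s - 1) * ((1 - 2 powr (- (1 - s))) * zeta (1 - s)) * mellin rat_kernel s)"
    using s by (intro sums_mult sums_mult2 odd_sums_zeta) auto
  ultimately show ?thesis
    using sums_unique2 by fastforce
qed

text \<open>Both Mellin transforms are holomorphic for \<open>-1 < Re s < 1\<close>, so the identity
  continues into the critical strip. The point 0 is removed because \<open>zeta (1 - s)\<close> has
  its pole there.\<close>

lemma mellin_logistic_deriv_eq: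
  assumes "-1 < Re s" "Re s < 1" "s \<noteq> 0"
  shows "mellin logistic_deriv s =
           2 * of_real pi powr (s - 1) * ((1 - 2 powr (s - 1)) * zeta (1 - s)) * mellin rat_kernel s"
proof (rule analytic_continuation_open[of "{s. Re s \<in> {-1<..<0}}" "{s. Re s \<in> {-1<..<1}} - {0}" "mellin logistic_deriv" _ s])
  have opn: "open {s. Re s \<in> {a<..<b}}" for a b :: real
    using open_vimage[of "{a<..<b}" Re] by (simp add: vimage_def continuous_on_Re continuous_on_id)
  show "open {s. Re s \<in> {-1<..<0}}" "open ({s. Re s \<in> {-1<..<1}} - {0})"
    by (intro open_delete opn)+
  show "{s. Re s \<in> {-1<..<0}} \<noteq> {}" by (auto intro!: exI[of _ "-1/2"])
  have "{s. Re s \<in> {-1<..<1}} = {s. Re s > -1} \<inter> {s. Re s < 1}" by auto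
  hence "convex {s. Re s \<in> {-1<..<1}}"
    by (simp only: convex_Int convex_halfspace_Re_gt convex_halfspace_Re_lt)
  thus "connected ({s. Re s \<in> {-1<..<1}} - {0::complex})"
    by (intro connected_open_delete opn convex_connected) auto
  have "mellin logistic_deriv holomorphic_on {s. Re s \<in> {-1<..}}"
    using continuous_logistic_deriv set_integrable_powr_logistic_deriv by (intro mellin_holomorphic) auto
  thus "mellin logistic_deriv holomorphic_on {s. Re s \<in> {-1<..<1}} - {0}"
    by (rule holomorphic_on_subset) auto
  have "mellin rat_kernel holomorphic_on {s. Re s \<in> {-1<..<1}}"
    using continuous_rat_kernel set_integrable_powr_rat_kernel by (intro mellin_holomorphic) auto
  hence "mellin rat_kernel holomorphic_on {s. Re s \<in> {-1<..<1}} - {0}"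
    by (rule holomorphic_on_subset) auto
  moreover have "(zeta \<circ> (\<lambda>s. 1 - s)) holomorphic_on {s. Re s \<in> {-1<..<1}} - {0}"
    by (intro holomorphic_on_compose_gen[OF _ zeta_holomorphic] holomorphic_intros) auto
  ultimately show "(\<lambda>s. 2 * of_real pi powr (s - 1) * ((1 - 2 powr (s - 1)) * zeta (1 - s)) * mellin rat_kernel s)
      holomorphic_on {s. Re s \<in> {-1<..<1}} - {0}"
    by (intro holomorphic_intros) (auto simp: o_def)
qed (use assms mellin_logistic_deriv_eq_left_strip in auto)

text \<open>The factor \<open>1 - 2 powr (1 - s)\<close> does not vanish, since
  \<open>2 powr (1 - s)\<close> has norm above 1 for \<open>Re s < 1\<close>.\<close>

lemma eta_eq_0_iff:
  assumes "0 < Re s" "Re s < 1"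
  shows "eta s = 0 \<longleftrightarrow> zeta s = 0"
proof -
  have "norm (2 powr (1 - s)) > 1"
    using assms norm_powr_real_powr[of 2 "1 - s"] by (simp add: gr_one_powr)
  hence "1 - 2 powr (1 - s) \<noteq> 0" by auto
  moreover have "s \<noteq> 1" using assms by auto
  ultimately show ?thesis using assms eta_eq_zeta[of s] by simp
qed

text \<open>At \<open>1 - s\<close> the right-hand side of the functional equation contains the
  factor \<open>zeta s = 0\<close>. The left-hand side is
  \<open>Gamma (2 - s) * eta (1 - s)\<close>, and \<open>Gamma\<close> has no zero there.\<close>

lemma zeta_zero_symmetric:
  assumes "0 < Re s" "Re s < 1" "zeta s = 0"
  shows "zeta (1 - s) = 0"
proof -
  have "mellin logistic_deriv (1 - s) = 0"
    using assms by (subst mellin_logistic_deriv_eq) auto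
  hence "Gamma (1 - s + 1) * eta (1 - s) = 0"
    using assms Gamma_mult_eta[of "1 - s"] by simp
  moreover have "1 - s + 1 \<notin> \<int>\<^sub>\<le>\<^sub>0"
    using assms by (auto elim!: nonpos_Ints_cases simp: complex_eq_iff)
  ultimately have "eta (1 - s) = 0" by (simp add: Gamma_eq_zero_iff)
  thus ?thesis using assms eta_eq_0_iff[of "1 - s"] by simp
qed

subsection \<open>Hurwitz argument\<close>

text \<open>A single value, from the Basel sum, that excludes \<open>eta\<close> vanishing
  identically.\<close>

lemma eta_2_nonzero: "eta 2 \<noteq> 0"
proof -
  have "(\<lambda>n. complex_of_real (1 / (real n + 1) ^ 2)) sums of_real (pi ^ 2 / 6)"
    using inverse_squares_sums by (subst sums_of_real_iff) (simp add: add_ac)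
  moreover have "complex_of_real (1 / (real n + 1) ^ 2) = 1 / of_nat (Suc n) powr 2" for n
    by (simp add: add_ac powr_numeral)
  ultimately have "zeta 2 = of_real (pi ^ 2 / 6)"
    using zeta_sums[of 2] sums_unique2 by fastforce
  hence "zeta 2 \<noteq> 0" by (simp only: of_real_eq_0_iff) simp
  thus ?thesis by (subst eta_eq_zeta_right_halfplane) (auto simp: powr_minus)
qed

text \<open>Supplies the non-constancy hypothesis of Hurwitz's theorem. A constant with a zero is 0
  on an open set, hence on the whole half-plane, against \<open>eta_2_nonzero\<close>.\<close>

lemma eta_not_constant:
  assumes "S \<subseteq> {s. Re s > -1}" "open S" "z \<in> S" "eta z = 0"
  shows "\<not> eta constant_on S"
proof
  assume "eta constant_on S"
  hence zero: "eta w = 0" if "w \<in> S" for w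
    using assms(3,4) that unfolding constant_on_def by metis
  have "eta 2 = 0"
  proof (rule analytic_continuation_open[of S "{s. Re s > -1}" eta "\<lambda>_. 0" 2])
    show "connected {s. Re s > -1}" by (intro convex_connected convex_halfspace_Re_gt)
  qed (use assms zero holomorphic_eta in \<open>auto intro: open_halfspace_Re_gt\<close>)
  thus False using eta_2_nonzero by simp
qed

lemma phi_holomorphic: "phi N holomorphic_on S"
  unfolding phi_def [abs_def] by (intro holomorphic_intros) auto

theorem theorem3p2:
  shows "Riemann_Hypothesis \<longleftrightarrow>
    (\<forall>(c::complex) (r::real). r > 0 \<and> cball c r \<subseteq> {s. 1 / 2 < Re s \<and> Re s < 1} \<longrightarrow>
      (\<exists>N0::nat. infinite {N. N > N0 \<and> (\<forall>s\<in>cball c r. phi N s \<noteq> 0)}))"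
proof (intro iffI allI impI)
  fix c :: complex and r :: real
  assume RH: "Riemann_Hypothesis" and disc: "r > 0 \<and> cball c r \<subseteq> {s. 1 / 2 < Re s \<and> Re s < 1}"
  have sub: "1 / 2 < Re s \<and> Re s < 1" if "s \<in> cball c r" for s
    using disc that by auto
  have nz: "eta s \<noteq> 0" if "s \<in> cball c r" for s
    using RH sub[OF that] eta_eq_0_iff[of s] unfolding Riemann_Hypothesis_def by force
  have "continuous_on (cball c r) (\<lambda>s. norm (eta s))"
    using sub by (intro continuous_on_norm holomorphic_on_imp_continuous_on holomorphic_on_subset[OF holomorphic_eta]) force
  moreover have "cball c r \<noteq> {}" using disc by simp
  \<comment> \<open>The minimum of \<open>norm (eta s)\<close> on the disc is positive, so any
    function closer to \<open>eta\<close> than that has no zero there.\<close>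
  ultimately obtain s0 where s0: "s0 \<in> cball c r" "\<And>s. s \<in> cball c r \<Longrightarrow> norm (eta s0) \<le> norm (eta s)"
    using continuous_attains_inf[OF compact_cball, of c r "\<lambda>s. norm (eta s)"] by blast
  have "uniform_limit (cball c r) phi eta sequentially"
    using sub by (intro uniform_limit_phi) force+
  from uniform_limitD[OF this, of "norm (eta s0)"]
  have "\<forall>\<^sub>F N in sequentially. \<forall>s\<in>cball c r. dist (phi N s) (eta s) < norm (eta s0)"
    using nz[OF s0(1)] by simp
  \<comment> \<open>All large \<open>N\<close> qualify, so \<open>N0 = 0\<close> serves as
    witness.\<close>
  hence "\<forall>\<^sub>F N in sequentially. N > 0 \<and> (\<forall>s\<in>cball c r. phi N s \<noteq> 0)"
    using eventually_gt_at_top[of 0] by eventually_elim (use s0(2) in force)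
  hence "infinite {N. N > 0 \<and> (\<forall>s\<in>cball c r. phi N s \<noteq> 0)}"
    unfolding INFM_iff_infinite[symmetric] cofinite_eq_sequentially
    by (intro eventually_frequently) auto
  thus "\<exists>N0. infinite {N. N > N0 \<and> (\<forall>s\<in>cball c r. phi N s \<noteq> 0)}" by blast
next
  assume *: "\<forall>c r. r > 0 \<and> cball c r \<subseteq> {s. 1 / 2 < Re s \<and> Re s < 1} \<longrightarrow>
      (\<exists>N0::nat. infinite {N. N > N0 \<and> (\<forall>s\<in>cball c r. phi N s \<noteq> 0)})"
  have no_zero: "zeta w \<noteq> 0" if w: "1 / 2 < Re w" "Re w < 1" for w
  proof
    assume "zeta w = 0"
    hence eta0: "eta w = 0" using w eta_eq_0_iff[of w] by simp
    \<comment> \<open>Half the distance from \<open>w\<close> to the nearer edge of the strip, so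
      that the closed disc stays strictly inside.\<close>
    define r where "r = min (Re w - 1 / 2) (1 - Re w) / 2"
    have r: "r > 0" using w by (simp add: r_def)
    have sub: "1 / 2 < Re s \<and> Re s < 1" if "s \<in> cball w r" for s
      using that abs_Re_le_cmod[of "w - s"] w by (auto simp: r_def dist_norm min_def split: if_splits)
    then obtain N0 where inf: "infinite {N. N > N0 \<and> (\<forall>s\<in>cball w r. phi N s \<noteq> 0)}"
      using * r by blast
    \<comment> \<open>The zero-free indices form a strictly increasing sequence, along which the
      uniform convergence persists.\<close>
    define h where "h = enumerate {N. N > N0 \<and> (\<forall>s\<in>cball w r. phi N s \<noteq> 0)}"
    have h: "strict_mono h" "\<And>n s. s \<in> cball w r \<Longrightarrow> phi (h n) s \<noteq> 0"
      using strict_mono_enumerate[OF inf] enumerate_in_set[OF inf] by (auto simp: h_def)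
    have ball_sub: "ball w r \<subseteq> {s. Re s > 0}"
    proof
      fix s assume "s \<in> ball w r"
      hence "1 / 2 < Re s" using sub[of s] by simp
      thus "s \<in> {s. Re s > 0}" by simp
    qed
    also have "{s. Re s > 0} \<subseteq> {s. Re s > -1}" by auto
    finally have ball_sub': "ball w r \<subseteq> {s. Re s > -1}" .
    have "eta w \<noteq> 0"
    proof (rule Hurwitz_no_zeros[of "ball w r" "\<lambda>n. phi (h n)" eta w])
      show "eta holomorphic_on ball w r"
        by (rule holomorphic_on_subset[OF holomorphic_eta ball_sub'])
      show "uniform_limit K (\<lambda>n. phi (h n)) eta sequentially" if "compact K" "K \<subseteq> ball w r" for K
      proof -
        have "uniform_limit K phi eta sequentially"
          using that ball_sub by (intro uniform_limit_phi) auto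
        thus ?thesis
          by (rule filterlim_compose[OF _ filterlim_subseq[OF h(1)]])
      qed
      show "\<not> eta constant_on ball w r"
        using ball_sub' r eta0 by (intro eta_not_constant[of _ w]) auto
    qed (use r h(2) phi_holomorphic in auto)
    thus False using eta0 by simp
  qed
  show "Riemann_Hypothesis"
    unfolding Riemann_Hypothesis_def
  proof (intro allI impI)
    fix s assume s: "0 < Re s \<and> Re s < 1 \<and> zeta s = 0"
    hence "zeta (1 - s) = 0" by (intro zeta_zero_symmetric) auto
    \<comment> \<open>Off the critical line, one of the zeros \<open>s\<close> and
      \<open>1 - s\<close> would lie to its right.\<close>
    thus "Re s = 1 / 2" using s no_zero[of s] no_zero[of "1 - s"] by force
  qed
qed

end
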